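(* Consider the finite-sum problem $\min_{x\in\mathbb{R}^d} f(x)$, $f=\frac1n\sum_{i=1}^n f_i$, and suppose that Assumptions (A1)--(A5) of the context hold. Run the SpiderSQN-M algorithm described in the context with $\alpha_k=\frac{2}{k+1}$, $q=|\xi_k|\equiv\sqrt n$, $$\beta_k\equiv\frac{\sigma_{\min}}{(3+\sqrt{15})\,L\,\sigma_{\max}^2},\qquad \lambda_k\in[\beta_k,(1+\alpha_k)\beta_k],$$ and let $z_\zeta$ be its output. Then, for any $\epsilon>0$, the output satisfies $\mathbb{E}\|\nabla f(z_\zeta)\|\le\epsilon$ provided that the number of iterations $K$ satisfies $$K\ge \mathcal{O}\Big(\frac{f(x_0)-f^*}{\epsilon^2}\Big).$$ Moreover, the total number of SFO calls (needed to achieve this) is at most in the order of $\mathcal{O}(n+n^{1/2}\epsilon^{-2})$.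
   Context: Norms are Euclidean for vectors and spectral for matrices; $A\preceq B$ means that $B-A$ is positive semidefinite. Assumptions. (A1) $f^*:=\inf_{x\in\mathbb{R}^d} f(x)>-\infty$. (A2) Each $f_i:\mathbb{R}^d\to\mathbb{R}$ is $L$-smooth with $L>0$: $\|\nabla f_i(x)-\nabla f_i(y)\|\le L\|x-y\|$ for all $x,y$. (A3) Each $f_i$ is twice continuously differentiable and there is $\kappa>0$ with $\|\nabla^2 f_i(x)\|\le\kappa$ for all $x$ and $i$. (A4) There are constants $\sigma_{\min},\sigma_{\max}>0$ with $\sigma_{\min}I\preceq H_k\preceq\sigma_{\max}I$ for all $k$, where $H_k$ is the inverse Hessian approximation matrix used at iteration $k$. (A5) For $k\ge2$, $H_k$ depends only on $v_{k-1}$ and $\xi_k$, and $\mathbb{E}[H_kv_k\mid \xi_k,v_{k-1}]=H_kv_k$. SpiderSQN-M algorithm. Start at $y_0=x_0\in\mathbb{R}^d$. For $k=0,\dots,K-1$: set $z_k=(1-\alpha_{k+1})y_k+\alpha_{k+1}x_k$; if $k\equiv0\pmod q$, set $v_k=\nabla f(z_k)$; otherwise draw a mini-batch $\xi_k$ of $|\xi_k|$ indices uniformly at random with replacement from $\{1,\dots,n\}$ and set $v_k=\nabla f_{\xi_k}(z_k)-\nabla f_{\xi_k}(z_{k-1})+v_{k-1}$, where $\nabla f_{\xi_k}(x)=\frac1{|\xi_k|}\sum_{i\in\xi_k}\nabla f_i(x)$. Compute $d_k=H_kv_k$ by SdLBFGS (below) and set $x_{k+1}=x_k-\lambda_kd_k$,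 $y_{k+1}=z_k-\beta_kd_k$. The output is $z_\zeta$ with $\zeta$ uniformly distributed on $\{0,\dots,K-1\}$. SdLBFGS (stochastic damped L-BFGS, memory size $m$, constant $\delta>0$). For $k\ge1$ put $s_{k-1}=x_k-x_{k-1}$, $\bar y_{k-1}=v_k-v_{k-1}$, $\gamma_k=\max\{\bar y_{k-1}^\top\bar y_{k-1}/(s_{k-1}^\top\bar y_{k-1}),\delta\}$, $H_{k,0}=\gamma_k^{-1}I$, $\sigma_{k-1}=s_{k-1}^\top H_{k,0}^{-1}s_{k-1}$, $\theta_{k-1}=\frac{0.75\sigma_{k-1}}{\sigma_{k-1}-s_{k-1}^\top\bar y_{k-1}}$ if $s_{k-1}^\top\bar y_{k-1}<0.25\sigma_{k-1}$ and $\theta_{k-1}=1$ otherwise, $\hat y_{k-1}=\theta_{k-1}\bar y_{k-1}+(1-\theta_{k-1})H_{k,0}^{-1}s_{k-1}$, $\rho_{k-1}=(s_{k-1}^\top\hat y_{k-1})^{-1}$. Starting from $H_{k,0}$, $H_k$ is obtained by applying, successively for the (at most $m$) most recent indices $j=k-m,\dots,k-1$ with $j\ge0$, the update $H\mapsto (I-\rho_js_j\hat y_j^\top)H(I-\rho_j\hat y_js_j^\top)+\rho_js_js_j^\top$. For $k=0$ there are no pairs and $H_0=H_{0,0}=\gamma_0^{-1}I$. An SFO (stochastic first-order oracle) call takes a sample index $i$ and a point $x$ and returns $(f_i(x),\nabla f_i(x))$; a full gradient costs $n$ calls. Integer rounding of $\sqrt n$ is suppressed. "$K\ge\mathcal{O}(A)$"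 means: there is a constant $C>0$ depending only on $L,\sigma_{\min},\sigma_{\max}$ such that $K\ge CA$ suffices. The SFO count refers to $K$ taken of this order; the hidden constant may depend on $L,\sigma_{\min},\sigma_{\max}$ and $f(x_0)-f^*$, but not on $n$ or $\epsilon$. *)

theory Defs
  imports "HOL-Probability.Probability" "Jordan_Normal_Form.Matrix"
begin

text \<open>
  The constants of the complexity bound must not depend on the dimension \<open>d\<close>, so \<open>d\<close> is quantified
  inside the existential quantifier of the theorem.  It can therefore not be a type parameter:
  points of \<open>\<real>\<^sup>d\<close> are the elements of \<^term>\<open>carrier_vec d\<close>, and functions on \<open>\<real>\<^sup>d\<close> are only ever
  evaluated and differentiated there.
\<close>

definition vnorm :: "real vec \<Rightarrow> real" where
  "vnorm x = sqrt (scalar_prod x x)"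

definition spectral_norm :: "real mat \<Rightarrow> real" where
  "spectral_norm A = (SUP u \<in> {u \<in> carrier_vec (dim_col A). vnorm u \<le> 1}. vnorm (A *\<^sub>v u))"

definition psd :: "nat \<Rightarrow> real mat \<Rightarrow> bool" where
  "psd d A \<longleftrightarrow> A \<in> carrier_mat d d \<and> transpose_mat A = A \<and>
     (\<forall>u \<in> carrier_vec d. 0 \<le> scalar_prod u (A *\<^sub>v u))"

definition loewner_le :: "nat \<Rightarrow> real mat \<Rightarrow> real mat \<Rightarrow> bool" where
  "loewner_le d A B \<longleftrightarrow> psd d (B - A)"

definition has_gradient :: "nat \<Rightarrow> (real vec \<Rightarrow> real) \<Rightarrow> real vec \<Rightarrow> real vec \<Rightarrow> bool" where
  "has_gradient d \<phi> x g \<longleftrightarrow> g \<in> carrier_vec d \<and>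
     (\<forall>e>0. \<exists>r>0. \<forall>h \<in> carrier_vec d. vnorm h < r \<longrightarrow>
        \<bar>\<phi> (x + h) - \<phi> x - scalar_prod g h\<bar> \<le> e * vnorm h)"

definition has_jacobian :: "nat \<Rightarrow> (real vec \<Rightarrow> real vec) \<Rightarrow> real vec \<Rightarrow> real mat \<Rightarrow> bool" where
  "has_jacobian d F x A \<longleftrightarrow> A \<in> carrier_mat d d \<and>
     (\<forall>e>0. \<exists>r>0. \<forall>h \<in> carrier_vec d. vnorm h < r \<longrightarrow>
        vnorm (F (x + h) - F x - A *\<^sub>v h) \<le> e * vnorm h)"

definition grad :: "nat \<Rightarrow> (real vec \<Rightarrow> real) \<Rightarrow> real vec \<Rightarrow> real vec" where
  "grad d \<phi> x = (THE g. has_gradient d \<phi> x g)"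

definition hess :: "nat \<Rightarrow> (real vec \<Rightarrow> real) \<Rightarrow> real vec \<Rightarrow> real mat" where
  "hess d \<phi> x = (THE A. has_jacobian d (grad d \<phi>) x A)"

definition differentiable_Rd :: "nat \<Rightarrow> (real vec \<Rightarrow> real) \<Rightarrow> bool" where
  "differentiable_Rd d \<phi> \<longleftrightarrow> (\<forall>x \<in> carrier_vec d. \<exists>g. has_gradient d \<phi> x g)"

definition L_smooth :: "nat \<Rightarrow> real \<Rightarrow> (real vec \<Rightarrow> real) \<Rightarrow> bool" where
  "L_smooth d L \<phi> \<longleftrightarrow> differentiable_Rd d \<phi> \<and>
     (\<forall>x \<in> carrier_vec d. \<forall>y \<in> carrier_vec d.
        vnorm (grad d \<phi> x - grad d \<phi> y) \<le> L * vnorm (x - y))"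

definition twice_continuously_differentiable :: "nat \<Rightarrow> (real vec \<Rightarrow> real) \<Rightarrow> bool" where
  "twice_continuously_differentiable d \<phi> \<longleftrightarrow> differentiable_Rd d \<phi> \<and>
     (\<forall>x \<in> carrier_vec d. \<exists>A. has_jacobian d (grad d \<phi>) x A) \<and>
     (\<forall>x \<in> carrier_vec d. \<forall>e>0. \<exists>r>0. \<forall>y \<in> carrier_vec d.
        vnorm (y - x) < r \<longrightarrow> spectral_norm (hess d \<phi> y - hess d \<phi> x) < e)"

definition objective :: "nat \<Rightarrow> (nat \<Rightarrow> real vec \<Rightarrow> real) \<Rightarrow> real vec \<Rightarrow> real" where
  "objective n f x = (\<Sum>i=1..n. f i x) / real n"

definition batch_grad :: "nat \<Rightarrow> (nat \<Rightarrow> real vec \<Rightarrow> real) \<Rightarrow> nat list \<Rightarrow> real vec \<Rightarrow> real vec" where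
  "batch_grad d f is x = vec d (\<lambda>j. (\<Sum>i\<leftarrow>is. grad d (f i) x $ j) / real (length is))"

text \<open>
  Law of the family of all mini-batches of a run of \<open>K\<close> iterations, with refresh period \<open>q\<close> and
  batch size \<open>b\<close>.  At the refresh iterations nothing is drawn and the batch is the dummy value
  \<^term>\<open>[]\<close>.
\<close>

definition batches :: "nat \<Rightarrow> nat \<Rightarrow> nat \<Rightarrow> nat \<Rightarrow> (nat \<Rightarrow> nat list) pmf" where
  "batches n q b K =
     Pi_pmf {k. k < K \<and> k mod q \<noteq> 0} [] (\<lambda>_. replicate_pmf b (pmf_of_set {1..n}))"

text \<open>
  All functions take the sequences \<open>x\<close> and \<open>v\<close> of a run.  The pair with index \<open>j\<close> is formed at
  iteration \<open>j + 1\<close>, hence uses \<open>\<gamma>\<^bsub>j+1\<^esub>\<close>.  Degenerate quotients follow \<open>a / 0 = 0\<close>: if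
  \<open>s\<^sup>T y = 0\<close> then \<open>\<gamma> = \<delta>\<close>, and if \<open>s = 0\<close> the update leaves \<open>H\<close> unchanged.
  The initial scaling \<open>\<gamma>\<^sub>0\<close>, for which no pair exists, is a parameter \<open>g0\<close>.
\<close>

definition pair_s :: "(nat \<Rightarrow> real vec) \<Rightarrow> nat \<Rightarrow> real vec" where
  "pair_s x j = x (j + 1) - x j"

definition pair_y :: "(nat \<Rightarrow> real vec) \<Rightarrow> nat \<Rightarrow> real vec" where
  "pair_y v j = v (j + 1) - v j"

definition sd_gamma ::
  "real \<Rightarrow> real \<Rightarrow> (nat \<Rightarrow> real vec) \<Rightarrow> (nat \<Rightarrow> real vec) \<Rightarrow> nat \<Rightarrow> real" where
  "sd_gamma \<delta> g0 x v k =
     (if k = 0 then g0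
      else let s = pair_s x (k - 1); y = pair_y v (k - 1)
           in max (scalar_prod y y / scalar_prod s y) \<delta>)"

definition sd_y_hat ::
  "nat \<Rightarrow> real \<Rightarrow> real \<Rightarrow> (nat \<Rightarrow> real vec) \<Rightarrow> (nat \<Rightarrow> real vec) \<Rightarrow> nat \<Rightarrow> real vec" where
  "sd_y_hat d \<delta> g0 x v j =
     (let s = pair_s x j; y = pair_y v j;
          B0 = sd_gamma \<delta> g0 x v (j + 1) \<cdot>\<^sub>m 1\<^sub>m d; \<comment> \<open>the inverse of \<open>H\<^bsub>j+1,0\<^esub>\<close>\<close>
          \<sigma> = scalar_prod s (B0 *\<^sub>v s);
          \<theta> = (if scalar_prod s y < 0.25 * \<sigma> then 0.75 * \<sigma> / (\<sigma> - scalar_prod s y) else 1)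
      in \<theta> \<cdot>\<^sub>v y + (1 - \<theta>) \<cdot>\<^sub>v (B0 *\<^sub>v s))"

definition outer_prod :: "real vec \<Rightarrow> real vec \<Rightarrow> real mat" where
  "outer_prod u w = mat (dim_vec u) (dim_vec w) (\<lambda>(i, j). u $ i * w $ j)"

definition bfgs_update :: "nat \<Rightarrow> real vec \<Rightarrow> real vec \<Rightarrow> real mat \<Rightarrow> real mat" where
  "bfgs_update d s y H =
     (let \<rho> = 1 / scalar_prod s y
      in (1\<^sub>m d - \<rho> \<cdot>\<^sub>m outer_prod s y) * H * (1\<^sub>m d - \<rho> \<cdot>\<^sub>m outer_prod y s) + \<rho> \<cdot>\<^sub>m outer_prod s s)"

text \<open>Truncated subtraction in \<open>k - m\<close> implements the restriction to indices \<open>j \<ge> 0\<close>.\<close>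

definition sd_lbfgs ::
  "nat \<Rightarrow> nat \<Rightarrow> real \<Rightarrow> real \<Rightarrow> (nat \<Rightarrow> real vec) \<Rightarrow> (nat \<Rightarrow> real vec) \<Rightarrow> nat \<Rightarrow> real mat" where
  "sd_lbfgs d m \<delta> g0 x v k =
     fold (\<lambda>j. bfgs_update d (pair_s x j) (sd_y_hat d \<delta> g0 x v j)) [k - m..<k]
       (inverse (sd_gamma \<delta> g0 x v k) \<cdot>\<^sub>m 1\<^sub>m d)"

definition spider_sqn_m_run ::
  "nat \<Rightarrow> nat \<Rightarrow> (nat \<Rightarrow> real vec \<Rightarrow> real) \<Rightarrow> nat \<Rightarrow> nat \<Rightarrow> real \<Rightarrow> real \<Rightarrow>
   (nat \<Rightarrow> real) \<Rightarrow> (nat \<Rightarrow> real) \<Rightarrow> (nat \<Rightarrow> real) \<Rightarrow> nat \<Rightarrow> real vec \<Rightarrow> (nat \<Rightarrow> nat list) \<Rightarrow>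
   (nat \<Rightarrow> real vec) \<Rightarrow> (nat \<Rightarrow> real vec) \<Rightarrow> (nat \<Rightarrow> real vec) \<Rightarrow> (nat \<Rightarrow> real vec) \<Rightarrow>
   (nat \<Rightarrow> real mat) \<Rightarrow> bool" where
  "spider_sqn_m_run d n f q m \<delta> g0 \<alpha> \<beta> \<Lambda> K x0 \<xi> x y z v H \<longleftrightarrow>
     x 0 = x0 \<and> y 0 = x0 \<and>
     (\<forall>k<K.
        z k = (1 - \<alpha> (k + 1)) \<cdot>\<^sub>v y k + \<alpha> (k + 1) \<cdot>\<^sub>v x k \<and>
        v k = (if k mod q = 0 then grad d (objective n f) (z k)
               else batch_grad d f (\<xi> k) (z k) - batch_grad d f (\<xi> k) (z (k - 1)) + v (k - 1)) \<and>
        H k = sd_lbfgs d m \<delta> g0 x v k \<and>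
        x (k + 1) = x k - \<Lambda> k \<cdot>\<^sub>v (H k *\<^sub>v v k) \<and>
        y (k + 1) = z k - \<beta> k \<cdot>\<^sub>v (H k *\<^sub>v v k))"

text \<open>
  A batch iteration evaluates each sampled component gradient at \<open>z\<^sub>k\<close> and at \<open>z\<^bsub>k-1\<^esub>\<close>.
\<close>

definition sfo_calls :: "nat \<Rightarrow> nat \<Rightarrow> nat \<Rightarrow> (nat \<Rightarrow> nat list) \<Rightarrow> nat" where
  "sfo_calls n q K \<xi> = (\<Sum>k<K. if k mod q = 0 then n else 2 * length (\<xi> k))"

definition hessian_approx_bounded ::
  "nat \<Rightarrow> real \<Rightarrow> real \<Rightarrow> nat \<Rightarrow> (nat \<Rightarrow> nat list) pmf \<Rightarrow>
   ((nat \<Rightarrow> nat list) \<Rightarrow> nat \<Rightarrow> real mat) \<Rightarrow> bool" where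
  "hessian_approx_bounded d smin smax K P H \<longleftrightarrow>
     (\<forall>\<xi> \<in> set_pmf P. \<forall>k<K.
        loewner_le d (smin \<cdot>\<^sub>m 1\<^sub>m d) (H \<xi> k) \<and> loewner_le d (H \<xi> k) (smax \<cdot>\<^sub>m 1\<^sub>m d))"

text \<open>
  The conditional expectation of the vector \<open>H\<^sub>k v\<^sub>k\<close> is taken componentwise, given the
  \<open>\<sigma>\<close>-algebra generated by \<open>(v\<^bsub>k-1\<^esub>, \<xi>\<^sub>k)\<close>.  This pair takes finitely many values almost surely,
  so its value space carries the discrete \<open>\<sigma>\<close>-algebra.
\<close>

definition hessian_approx_dependence ::
  "nat \<Rightarrow> nat \<Rightarrow> (nat \<Rightarrow> nat list) pmf \<Rightarrow> ((nat \<Rightarrow> nat list) \<Rightarrow> nat \<Rightarrow> real vec) \<Rightarrow>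
   ((nat \<Rightarrow> nat list) \<Rightarrow> nat \<Rightarrow> real mat) \<Rightarrow> bool" where
  "hessian_approx_dependence d K P v H \<longleftrightarrow>
     (\<forall>k. 2 \<le> k \<and> k < K \<longrightarrow>
        (\<exists>\<Phi>. \<forall>\<xi> \<in> set_pmf P. H \<xi> k = \<Phi> (v \<xi> (k - 1)) (\<xi> k)) \<and>
        (\<forall>j<d. AE \<xi> in measure_pmf P.
           real_cond_exp (measure_pmf P)
             (vimage_algebra UNIV (\<lambda>\<xi>. (v \<xi> (k - 1), \<xi> k)) (count_space UNIV))
             (\<lambda>\<xi>. (H \<xi> k *\<^sub>v v \<xi> k) $ j) \<xi> = (H \<xi> k *\<^sub>v v \<xi> k) $ j))"

end

theory Submission
  imports Defs
begin

text \<open>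
  With \<open>p\<^sub>k = \<parallel>x\<^sub>k - y\<^sub>k\<parallel>\<^sup>2\<close> and \<open>D\<^sub>k = \<parallel>H\<^sub>k v\<^sub>k\<parallel>\<^sup>2\<close>, the descent lemma at \<open>x\<^sub>k\<close> loses the estimator error
  \<open>\<parallel>v\<^sub>k - \<nabla>f(z\<^sub>k)\<parallel>\<^sup>2\<close> and a multiple of \<open>p\<^sub>k\<close>.  Convexity gives the contraction
  \<open>p\<^bsub>k+1\<^esub> \<le> (1 - \<alpha>\<^bsub>k+1\<^esub>) p\<^sub>k + (\<lambda>\<^sub>k - \<beta>)\<^sup>2/\<alpha>\<^bsub>k+1\<^esub> D\<^sub>k\<close>, so weighted sums of the \<open>p\<^sub>k\<close> are bounded by sums of
  the \<open>D\<^sub>k\<close>.  The estimator error is a martingale within an epoch whose increments have variance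
  at most \<open>L\<^sup>2/q \<parallel>z\<^sub>k - z\<^bsub>k-1\<^esub>\<parallel>\<^sup>2\<close>; since epochs have length \<open>q\<close>, its total over a run is at most
  \<open>L\<^sup>2 \<Sum>\<parallel>z\<^sub>k - z\<^bsub>k-1\<^esub>\<parallel>\<^sup>2\<close>, again controlled by the \<open>D\<^sub>k\<close>.  For the prescribed \<open>\<beta>\<close> the coefficient of
  each \<open>D\<^sub>k\<close> remains negative, which bounds \<open>\<Sum> E D\<^sub>k\<close> by a constant multiple of \<open>f(x\<^sub>0) - f\<^sup>*\<close>.
\<close>

unbundle no vec_syntax

subsection \<open>Gradients and smoothness on coordinate vectors\<close>

lemma vnorm_power2: "(vnorm x)\<^sup>2 = (\<Sum>i<dim_vec x. (x $ i)\<^sup>2)"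
proof -
  have "scalar_prod x x = (\<Sum>i<dim_vec x. (x $ i)\<^sup>2)"
    by (simp add: scalar_prod_def power2_eq_square atLeast0LessThan)
  then show ?thesis
    by (simp add: vnorm_def sum_nonneg)
qed

lemma vnorm_power2_scalar_prod: "(vnorm x)\<^sup>2 = scalar_prod x x"
  unfolding vnorm_power2 by (simp add: scalar_prod_def power2_eq_square atLeast0LessThan)

lemma vnorm_L2_set: "vnorm x = L2_set (\<lambda>i. x $ i) {..<dim_vec x}"
  by (simp add: vnorm_def L2_set_def scalar_prod_def power2_eq_square atLeast0LessThan)

lemma vnorm_nonneg [simp]: "0 \<le> vnorm x"
  by (simp add: vnorm_L2_set)

lemma vnorm_smult: "vnorm (c \<cdot>\<^sub>v x) = \<bar>c\<bar> * vnorm x"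
proof -
  have "(vnorm (c \<cdot>\<^sub>v x))\<^sup>2 = (\<bar>c\<bar> * vnorm x)\<^sup>2"
    by (simp add: vnorm_power2 power_mult_distrib sum_distrib_left)
  then show ?thesis
    by (metis abs_ge_zero mult_nonneg_nonneg power2_eq_imp_eq vnorm_nonneg)
qed

lemma abs_scalar_prod_le:
  assumes "dim_vec x = dim_vec y"
  shows "\<bar>scalar_prod x y\<bar> \<le> vnorm x * vnorm y"
proof -
  have "\<bar>scalar_prod x y\<bar> \<le> (\<Sum>i<dim_vec x. \<bar>x $ i\<bar> * \<bar>y $ i\<bar>)"
    using assms by (simp add: scalar_prod_def atLeast0LessThan abs_mult[symmetric])
  also have "\<dots> \<le> vnorm x * vnorm y"
    using L2_set_mult_ineq[of "\<lambda>i. x $ i" "\<lambda>i. y $ i" "{..<dim_vec x}"] assms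
    by (simp add: vnorm_L2_set)
  finally show ?thesis .
qed

lemma vnorm_eq_0_imp:
  assumes "x \<in> carrier_vec d" "vnorm x = 0"
  shows "x = 0\<^sub>v d"
proof -
  have "(\<Sum>i<d. (x $ i)\<^sup>2) = 0"
    using vnorm_power2[of x] assms by simp
  then have "\<forall>i<d. x $ i = 0"
    by (subst (asm) sum_nonneg_eq_0_iff) auto
  then show ?thesis
    using assms by (intro eq_vecI) auto
qed

text \<open>Testing both first-order expansions on a short multiple of \<open>w = g - g'\<close>
  gives \<open>vnorm w \<le> 2 * e\<close> for every positive \<open>e\<close>. Uniqueness makes the
  definite description \<open>grad\<close> usable.\<close>

lemma has_gradient_unique:
  assumes g: "has_gradient d \<phi> x g" and g': "has_gradient d \<phi> x g'"
  shows "g = g'"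
proof -
  define w where "w = g - g'"
  have gc: "g \<in> carrier_vec d" "g' \<in> carrier_vec d"
    using g g' by (auto simp: has_gradient_def)
  then have wc: "w \<in> carrier_vec d" by (simp add: w_def)
  have "vnorm w \<le> 2 * e" if e: "e > 0" for e
  proof -
    obtain r where r: "r > 0" "\<And>h. h \<in> carrier_vec d \<Longrightarrow> vnorm h < r \<Longrightarrow>
        \<bar>\<phi> (x + h) - \<phi> x - scalar_prod g h\<bar> \<le> e * vnorm h"
      using g e by (auto simp: has_gradient_def)
    obtain r' where r': "r' > 0" "\<And>h. h \<in> carrier_vec d \<Longrightarrow> vnorm h < r' \<Longrightarrow>
        \<bar>\<phi> (x + h) - \<phi> x - scalar_prod g' h\<bar> \<le> e * vnorm h"
      using g' e by (auto simp: has_gradient_def)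
    \<comment> \<open>The multiple of \<open>w\<close> by \<open>t\<close> lies inside both radii;
      the added 1 keeps the quotient meaningful when \<open>w\<close> vanishes.\<close>
    define t where "t = min r r' / 2 / (vnorm w + 1)"
    have "min r r' > 0" using r(1) r'(1) by simp
    have "vnorm w + 1 > 0" using vnorm_nonneg[of w] by linarith
    then have t: "t > 0" using r(1) r'(1) by (simp add: t_def)
    have "t * vnorm w < min r r'"
    proof -
      have "t * vnorm w \<le> t * (vnorm w + 1)" using t by simp
      also have "\<dots> = min r r' / 2"
        using \<open>vnorm w + 1 > 0\<close> unfolding t_def by (metis nonzero_divide_eq_eq order_less_irrefl)
      also have "\<dots> < min r r'" using \<open>min r r' > 0\<close> by linarith
      finally show ?thesis .
    qed
    then have small: "vnorm (t \<cdot>\<^sub>v w) < r" "vnorm (t \<cdot>\<^sub>v w) < r'"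
      using t by (simp_all add: vnorm_smult)
    have hc: "t \<cdot>\<^sub>v w \<in> carrier_vec d" using wc by simp
    have "scalar_prod g (t \<cdot>\<^sub>v w) - scalar_prod g' (t \<cdot>\<^sub>v w) = scalar_prod w (t \<cdot>\<^sub>v w)"
      using gc hc by (simp add: w_def minus_scalar_prod_distrib right_diff_distrib)
    also have "\<dots> = t * (vnorm w)\<^sup>2"
      using wc by (simp add: vnorm_power2_scalar_prod)
    finally have "t * (vnorm w)\<^sup>2 \<le> 2 * (e * vnorm (t \<cdot>\<^sub>v w))"
      using r(2)[OF hc small(1)] r'(2)[OF hc small(2)] by linarith
    then have "t * (vnorm w)\<^sup>2 \<le> t * (2 * e * vnorm w)"
      using t by (simp add: vnorm_smult algebra_simps)
    then have "vnorm w * vnorm w \<le> 2 * e * vnorm w"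
      using t by (simp add: power2_eq_square)
    then show ?thesis
      using vnorm_nonneg[of w] e by (cases "vnorm w = 0") auto
  qed
  \<comment> \<open>For this \<open>e\<close> the bound reads
    \<open>vnorm w \<le> vnorm w / 2\<close>.\<close>
  from this[of "vnorm w / 4"] have "vnorm w = 0"
    using vnorm_nonneg[of w] by (cases "vnorm w = 0") auto
  then have w0: "w = 0\<^sub>v d" using wc vnorm_eq_0_imp by blast
  show ?thesis
  proof (rule eq_vecI)
    show "g $ i = g' $ i" if "i < dim_vec g'" for i
      using arg_cong[OF w0, of "\<lambda>u. u $ i"] that gc by (simp add: w_def)
  qed (use gc in simp)
qed

lemma grad_eq: "has_gradient d \<phi> x g \<Longrightarrow> grad d \<phi> x = g"
  unfolding grad_def using has_gradient_unique by blast

lemma has_gradient_grad: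
  assumes "differentiable_Rd d \<phi>" "x \<in> carrier_vec d"
  shows "has_gradient d \<phi> x (grad d \<phi> x)"
  using assms grad_eq unfolding differentiable_Rd_def by metis

lemma grad_carrier:
  assumes "differentiable_Rd d \<phi>" "x \<in> carrier_vec d"
  shows "grad d \<phi> x \<in> carrier_vec d"
  using has_gradient_grad[OF assms] by (simp add: has_gradient_def)

section \<open>Gradient and smoothness of the averaged objective\<close>

lemma has_gradient_mean:
  assumes n: "n \<ge> 1" and f: "\<And>i. i \<in> {1..n} \<Longrightarrow> has_gradient d (f i) x (g i)"
  shows "has_gradient d (objective n f) x (vec d (\<lambda>j. (\<Sum>i=1..n. g i $ j) / real n))"
  unfolding has_gradient_def
proof (intro conjI allI impI)
  let ?g = "vec d (\<lambda>j. (\<Sum>i=1..n. g i $ j) / real n)"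
  show "?g \<in> carrier_vec d" by simp
  fix e :: real assume e: "e > 0"
  have "\<forall>i\<in>{1..n}. \<exists>r>0. \<forall>h \<in> carrier_vec d. vnorm h < r \<longrightarrow>
        \<bar>f i (x + h) - f i x - scalar_prod (g i) h\<bar> \<le> e * vnorm h"
    using f e by (auto simp: has_gradient_def)
  then obtain R where R: "\<And>i. i \<in> {1..n} \<Longrightarrow> R i > 0" "\<And>i h. i \<in> {1..n} \<Longrightarrow>
      h \<in> carrier_vec d \<Longrightarrow> vnorm h < R i \<Longrightarrow>
        \<bar>f i (x + h) - f i x - scalar_prod (g i) h\<bar> \<le> e * vnorm h"
    by metis
  define r where "r = Min (R ` {1..n})"
  have "r > 0" using R(1) n by (auto simp: r_def Min_gr_iff)
  moreover have "\<bar>objective n f (x + h) - objective n f x - scalar_prod ?g h\<bar> \<le> e * vnorm h"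
    if h: "h \<in> carrier_vec d" "vnorm h < r" for h
  proof -
    have le: "r \<le> R i" if "i \<in> {1..n}" for i using that by (auto simp: r_def)
    have "scalar_prod ?g h = (\<Sum>j<d. (\<Sum>i=1..n. g i $ j * h $ j) / real n)"
      using h by (simp add: scalar_prod_def atLeast0LessThan sum_distrib_right)
    also have "\<dots> = (\<Sum>i=1..n. scalar_prod (g i) h) / real n"
      using h by (subst sum_divide_distrib[symmetric], subst sum.swap)
        (simp add: scalar_prod_def atLeast0LessThan)
    finally have "\<bar>objective n f (x + h) - objective n f x - scalar_prod ?g h\<bar>
        = \<bar>\<Sum>i=1..n. f i (x + h) - f i x - scalar_prod (g i) h\<bar> / real n"
      by (simp add: objective_def sum_subtractf diff_divide_distrib[symmetric] abs_divide)
    also have "\<dots> \<le> (\<Sum>i=1..n. e * vnorm h) / real n"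
      using R(2) h le by (intro divide_right_mono order_trans[OF sum_abs] sum_mono)
        (auto intro: less_le_trans)
    also have "\<dots> = e * vnorm h" using n by simp
    finally show ?thesis .
  qed
  ultimately show "\<exists>r>0. \<forall>h\<in>carrier_vec d. vnorm h < r \<longrightarrow>
       \<bar>objective n f (x + h) - objective n f x - scalar_prod ?g h\<bar> \<le> e * vnorm h"
    by blast
qed

lemma grad_objective:
  assumes "n \<ge> 1" "\<And>i. i \<in> {1..n} \<Longrightarrow> differentiable_Rd d (f i)" "x \<in> carrier_vec d"
  shows "grad d (objective n f) x = vec d (\<lambda>j. (\<Sum>i=1..n. grad d (f i) x $ j) / real n)"
  using assms by (intro grad_eq has_gradient_mean has_gradient_grad) auto

lemma differentiable_objective:
  assumes "n \<ge> 1" "\<And>i. i \<in> {1..n} \<Longrightarrow> differentiable_Rd d (f i)"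
  shows "differentiable_Rd d (objective n f)"
proof -
  have "has_gradient d (objective n f) x (vec d (\<lambda>j. (\<Sum>i=1..n. grad d (f i) x $ j) / real n))"
    if "x \<in> carrier_vec d" for x
    using assms that by (intro has_gradient_mean has_gradient_grad) auto
  then show ?thesis unfolding differentiable_Rd_def by blast
qed

text \<open>Jensen's inequality for the square, from nonnegativity of the summed squared deviations
  from the mean.\<close>

lemma sum_power2_mean_le:
  fixes g :: "nat \<Rightarrow> real"
  assumes "n \<ge> 1"
  shows "((\<Sum>i=1..n. g i) / real n)\<^sup>2 \<le> (\<Sum>i=1..n. (g i)\<^sup>2) / real n"
proof -
  define m where "m = (\<Sum>i=1..n. g i) / real n"
  have "0 \<le> (\<Sum>i=1..n. (g i - m)\<^sup>2)" by (simp add: sum_nonneg)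
  also have "\<dots> = (\<Sum>i=1..n. (g i)\<^sup>2) - 2 * m * (\<Sum>i=1..n. g i) + real n * m\<^sup>2"
    by (simp add: power2_diff sum.distrib sum_subtractf sum_distrib_left algebra_simps)
  also have "(\<Sum>i=1..n. g i) = real n * m" using assms by (simp add: m_def)
  finally have "real n * m\<^sup>2 \<le> (\<Sum>i=1..n. (g i)\<^sup>2)"
    by (simp add: power2_eq_square algebra_simps)
  then have "m\<^sup>2 \<le> (\<Sum>i=1..n. (g i)\<^sup>2) / real n"
    using assms by (simp add: pos_le_divide_eq mult.commute)
  then show ?thesis by (simp add: m_def)
qed

text \<open>Jensen's inequality is applied in each coordinate of the gradient difference; swapping
  the two sums then reassembles the squared norms of the components.\<close>

lemma L_smooth_objective:
  assumes n: "n \<ge> 1" and L: "L \<ge> 0" and f: "\<And>i. i \<in> {1..n} \<Longrightarrow> L_smooth d L (f i)"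
  shows "L_smooth d L (objective n f)"
  unfolding L_smooth_def
proof (intro conjI ballI)
  have diff: "\<And>i. i \<in> {1..n} \<Longrightarrow> differentiable_Rd d (f i)" using f by (auto simp: L_smooth_def)
  show "differentiable_Rd d (objective n f)"
    by (rule differentiable_objective[OF n diff])
  fix x y :: "real vec" assume xy: "x \<in> carrier_vec d" "y \<in> carrier_vec d"
  have gc: "grad d (f i) x \<in> carrier_vec d" "grad d (f i) y \<in> carrier_vec d" if "i \<in> {1..n}" for i
    using grad_carrier diff that xy by blast+
  have G: "grad d (objective n f) u = vec d (\<lambda>j. (\<Sum>i=1..n. grad d (f i) u $ j) / real n)"
    if "u \<in> carrier_vec d" for u
    by (rule grad_objective[OF n _ that]) (rule diff)
  have "(vnorm (grad d (objective n f) x - grad d (objective n f) y))\<^sup>2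
      = (\<Sum>j<d. ((\<Sum>i=1..n. (grad d (f i) x - grad d (f i) y) $ j) / real n)\<^sup>2)"
    unfolding vnorm_power2 G[OF xy(1)] G[OF xy(2)]
    using gc[THEN carrier_vecD] by (intro sum.cong refl)
      (auto simp: diff_divide_distrib[symmetric] sum_subtractf[symmetric] intro!: sum.cong arg_cong[of _ _ "\<lambda>u. u\<^sup>2"] arg_cong2[of _ _ _ _ "(/)"])
  also have "\<dots> \<le> (\<Sum>j<d. (\<Sum>i=1..n. ((grad d (f i) x - grad d (f i) y) $ j)\<^sup>2) / real n)"
    by (intro sum_mono sum_power2_mean_le n)
  also have "\<dots> = (\<Sum>i=1..n. (vnorm (grad d (f i) x - grad d (f i) y))\<^sup>2) / real n"
  proof -
    have "(\<Sum>j<d. ((grad d (f i) x - grad d (f i) y) $ j)\<^sup>2)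
        = (vnorm (grad d (f i) x - grad d (f i) y))\<^sup>2" if "i \<in> {1..n}" for i
      using gc(2)[OF that] by (simp add: vnorm_power2)
    then show ?thesis
      by (subst sum_divide_distrib[symmetric], subst sum.swap) simp
  qed
  also have "\<dots> \<le> (\<Sum>i=1..n. (L * vnorm (x - y))\<^sup>2) / real n"
    using f xy by (intro divide_right_mono sum_mono power_mono) (auto simp: L_smooth_def)
  also have "\<dots> = (L * vnorm (x - y))\<^sup>2" using n by simp
  finally show "vnorm (grad d (objective n f) x - grad d (objective n f) y) \<le> L * vnorm (x - y)"
    by (rule power2_le_imp_le) (use L in simp)
qed

section \<open>The descent lemma along a segment\<close>

lemma has_gradient_line:
  assumes x: "x \<in> carrier_vec d" and h: "h \<in> carrier_vec d"
    and g: "has_gradient d \<phi> (x + t \<cdot>\<^sub>v h) g"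
  shows "((\<lambda>s. \<phi> (x + s \<cdot>\<^sub>v h)) has_real_derivative scalar_prod g h) (at t)"
  unfolding has_field_derivative_def has_derivative_at_alt
proof (intro conjI allI impI)
  show "bounded_linear ((*) (scalar_prod g h))" by (rule bounded_linear_mult_right)
  fix e :: real assume e: "e > 0"
  define e' where "e' = e / (vnorm h + 1)"
  have pos: "vnorm h + 1 > 0" using vnorm_nonneg[of h] by linarith
  have e': "e' > 0" using e pos by (simp add: e'_def)
  obtain r where r: "r > 0" "\<And>u. u \<in> carrier_vec d \<Longrightarrow> vnorm u < r \<Longrightarrow>
      \<bar>\<phi> (x + t \<cdot>\<^sub>v h + u) - \<phi> (x + t \<cdot>\<^sub>v h) - scalar_prod g u\<bar> \<le> e' * vnorm u"
    using g e' by (auto simp: has_gradient_def)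
  have gc: "g \<in> carrier_vec d" using g by (simp add: has_gradient_def)
  show "\<exists>r>0. \<forall>s. norm (s - t) < r \<longrightarrow>
      norm (\<phi> (x + s \<cdot>\<^sub>v h) - \<phi> (x + t \<cdot>\<^sub>v h) - scalar_prod g h * (s - t)) \<le> e * norm (s - t)"
  proof (intro exI conjI allI impI)
    show "r / (vnorm h + 1) > 0" using r(1) pos by simp
    fix s assume s: "norm (s - t) < r / (vnorm h + 1)"
    let ?u = "(s - t) \<cdot>\<^sub>v h"
    have "\<bar>s - t\<bar> * vnorm h \<le> \<bar>s - t\<bar> * (vnorm h + 1)" by (simp add: mult_left_mono)
    also have "\<dots> < r" using s pos by (simp add: field_simps)
    finally have small: "vnorm ?u < r" by (simp add: vnorm_smult)
    have eq: "x + t \<cdot>\<^sub>v h + ?u = x + s \<cdot>\<^sub>v h"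
      using x h by (intro eq_vecI) (auto simp: algebra_simps)
    have "\<bar>\<phi> (x + s \<cdot>\<^sub>v h) - \<phi> (x + t \<cdot>\<^sub>v h) - scalar_prod g ?u\<bar> \<le> e' * vnorm ?u"
      using r(2)[of ?u] small h unfolding eq by simp
    also have "e' * vnorm ?u = (e' * vnorm h) * \<bar>s - t\<bar>" by (simp add: vnorm_smult)
    also have "\<dots> \<le> e * \<bar>s - t\<bar>"
    proof (rule mult_right_mono)
      have "e' * vnorm h \<le> e' * (vnorm h + 1)" using e' by simp
      also have "\<dots> = e" using pos by (simp add: e'_def)
      finally show "e' * vnorm h \<le> e" .
    qed simp
    also have "scalar_prod g ?u = scalar_prod g h * (s - t)" using gc h by simp
    finally show "norm (\<phi> (x + s \<cdot>\<^sub>v h) - \<phi> (x + t \<cdot>\<^sub>v h) - scalar_prod g h * (s - t))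
        \<le> e * norm (s - t)" by simp
  qed
qed

text \<open>On the segment from \<open>x\<close> to \<open>x + h\<close>, subtracting the linear and
  quadratic terms of the upper model leaves a function \<open>\<psi>\<close> whose derivative is
  nonpositive by Cauchy-Schwarz and the Lipschitz gradient. Comparing endpoints avoids an
  integral.\<close>

lemma L_smooth_descent:
  assumes \<phi>: "L_smooth d L \<phi>" and x: "x \<in> carrier_vec d" and h: "h \<in> carrier_vec d"
  shows "\<phi> (x + h) \<le> \<phi> x + scalar_prod (grad d \<phi> x) h + L / 2 * (vnorm h)\<^sup>2"
proof -
  have diff: "differentiable_Rd d \<phi>" using \<phi> by (simp add: L_smooth_def)
  let ?G = "\<lambda>t. grad d \<phi> (x + t \<cdot>\<^sub>v h)"
  define \<psi> where "\<psi> t = \<phi> (x + t \<cdot>\<^sub>v h) - t * scalar_prod (grad d \<phi> x) h - L * t\<^sup>2 / 2 * (vnorm h)\<^sup>2"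
    for t
  have "\<psi> 1 \<le> \<psi> 0"
  proof (rule DERIV_nonpos_imp_nonincreasing[of 0 1 \<psi>])
    fix t :: real assume t: "0 \<le> t" "t \<le> 1"
    have c: "x + t \<cdot>\<^sub>v h \<in> carrier_vec d" using x h by simp
    have gc: "?G t \<in> carrier_vec d" "grad d \<phi> x \<in> carrier_vec d"
      using grad_carrier[OF diff] c x by auto
    have "(\<psi> has_real_derivative
        scalar_prod (?G t) h - scalar_prod (grad d \<phi> x) h - L * t * (vnorm h)\<^sup>2) (at t)"
      unfolding \<psi>_def
      by (rule derivative_eq_intros has_gradient_line[OF x h has_gradient_grad[OF diff c]] refl | simp)+
    moreover have "scalar_prod (?G t) h - scalar_prod (grad d \<phi> x) h \<le> L * t * (vnorm h)\<^sup>2"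
    proof -
      have "scalar_prod (?G t) h - scalar_prod (grad d \<phi> x) h
          = scalar_prod (?G t - grad d \<phi> x) h"
        using gc h by (simp add: minus_scalar_prod_distrib)
      also have "\<dots> \<le> vnorm (?G t - grad d \<phi> x) * vnorm h"
        using abs_scalar_prod_le[of "?G t - grad d \<phi> x" h] gc h by simp
      also have "\<dots> \<le> L * vnorm (x + t \<cdot>\<^sub>v h - x) * vnorm h"
        using \<phi> c x by (intro mult_right_mono) (auto simp: L_smooth_def)
      also have "x + t \<cdot>\<^sub>v h - x = t \<cdot>\<^sub>v h" using x h by (intro eq_vecI) auto
      finally show ?thesis using t by (simp add: vnorm_smult power2_eq_square mult.assoc)
    qed
    ultimately show "\<exists>y. (\<psi> has_real_derivative y) (at t) \<and> y \<le> 0"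
      by (intro exI conjI) auto
  qed simp
  moreover have "x + 0 \<cdot>\<^sub>v h = x" using x h by (intro eq_vecI) auto
  then have "\<psi> 0 = \<phi> x" by (simp add: \<psi>_def)
  moreover have "\<psi> 1 = \<phi> (x + h) - scalar_prod (grad d \<phi> x) h - L / 2 * (vnorm h)\<^sup>2"
    by (simp add: \<psi>_def)
  ultimately show ?thesis by linarith
qed

section \<open>Consequences of the spectral bounds on the Hessian approximation\<close>

text \<open>The second bound combines \<open>vnorm (H *\<^sub>v v) \<le> smax * vnorm v\<close> with
  the lower spectral bound; its factor \<open>smin / smax\<^sup>2\<close> is the one occurring in
  the prescribed step size. The third recovers the size of \<open>v\<close> from that of the search
  direction.\<close>

lemma loewner_bounds:
  assumes lo: "loewner_le d (smin \<cdot>\<^sub>m 1\<^sub>m d) H" and hi: "loewner_le d H (smax \<cdot>\<^sub>m 1\<^sub>m d)"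
    and s: "smin > 0" "smax > 0" and v: "v \<in> carrier_vec d"
  shows "H \<in> carrier_mat d d"
    and "smin / smax\<^sup>2 * (vnorm (H *\<^sub>v v))\<^sup>2 \<le> scalar_prod v (H *\<^sub>v v)"
    and "smin * vnorm v \<le> vnorm (H *\<^sub>v v)"
proof -
  show Hc: "H \<in> carrier_mat d d"
  proof
    \<comment> \<open>A difference of matrices takes its dimensions from the subtrahend, so its
      carrier determines the dimensions of \<open>H\<close>.\<close>
    have "smax \<cdot>\<^sub>m 1\<^sub>m d - H \<in> carrier_mat d d" using hi by (simp add: loewner_le_def psd_def)
    then show "dim_row H = d" "dim_col H = d"
      using index_minus_mat(2,3)[of "smax \<cdot>\<^sub>m 1\<^sub>m d" H] by (metis carrier_matD)+
  qed
  have symd: "(H - smin \<cdot>\<^sub>m 1\<^sub>m d)\<^sup>T = H - smin \<cdot>\<^sub>m 1\<^sub>m d"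
    using lo by (simp add: loewner_le_def psd_def)
  have Hsym: "H $$ (i, j) = H $$ (j, i)" if "i < d" "j < d" for i j
  proof -
    have "(H - smin \<cdot>\<^sub>m 1\<^sub>m d) $$ (j, i) = (H - smin \<cdot>\<^sub>m 1\<^sub>m d) $$ (i, j)"
      using arg_cong[OF symd, of "\<lambda>M. M $$ (i, j)"] that by simp
    then show ?thesis using that Hc by (auto split: if_splits)
  qed
  have HT: "H\<^sup>T = H" using Hc Hsym by (intro eq_matI) auto
  have smult_one: "(c \<cdot>\<^sub>m 1\<^sub>m d) *\<^sub>v u = c \<cdot>\<^sub>v u" if "u \<in> carrier_vec d" for u :: "real vec" and c
  proof (rule eq_vecI)
    have "row (c \<cdot>\<^sub>m 1\<^sub>m d) i = c \<cdot>\<^sub>v unit_vec d i" if "i < d" for i :: nat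
      using that by (intro eq_vecI) auto
    then show "((c \<cdot>\<^sub>m 1\<^sub>m d) *\<^sub>v u) $ i = (c \<cdot>\<^sub>v u) $ i" if "i < dim_vec (c \<cdot>\<^sub>v u)" for i
      using that \<open>u \<in> carrier_vec d\<close> by simp
  qed (use that in simp)
  have low: "smin * (vnorm u)\<^sup>2 \<le> scalar_prod u (H *\<^sub>v u)" if u: "u \<in> carrier_vec d" for u
  proof -
    have "0 \<le> scalar_prod u ((H - smin \<cdot>\<^sub>m 1\<^sub>m d) *\<^sub>v u)"
      using lo u by (simp add: loewner_le_def psd_def)
    also have "(H - smin \<cdot>\<^sub>m 1\<^sub>m d) *\<^sub>v u = H *\<^sub>v u - smin \<cdot>\<^sub>v u"
      using u Hc by (subst minus_mult_distrib_mat_vec[of _ d d]) (auto simp: smult_one)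
    finally show ?thesis
      using u Hc by (simp add: scalar_prod_minus_distrib[of _ d] vnorm_power2_scalar_prod)
  qed
  have up: "scalar_prod u (H *\<^sub>v u) \<le> smax * (vnorm u)\<^sup>2" if u: "u \<in> carrier_vec d" for u
  proof -
    have "0 \<le> scalar_prod u ((smax \<cdot>\<^sub>m 1\<^sub>m d - H) *\<^sub>v u)"
      using hi u by (simp add: loewner_le_def psd_def)
    also have "(smax \<cdot>\<^sub>m 1\<^sub>m d - H) *\<^sub>v u = smax \<cdot>\<^sub>v u - H *\<^sub>v u"
      using u Hc by (subst minus_mult_distrib_mat_vec[of _ d d]) (auto simp: smult_one)
    finally show ?thesis
      using u Hc by (simp add: scalar_prod_minus_distrib[of _ d] vnorm_power2_scalar_prod)
  qed
  define w where "w = H *\<^sub>v v"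
  have wc: "w \<in> carrier_vec d" and Hwc: "H *\<^sub>v w \<in> carrier_vec d" using Hc v by (auto simp: w_def)
  have vHw: "scalar_prod v (H *\<^sub>v w) = (vnorm w)\<^sup>2"
  proof -
    have "scalar_prod v (H *\<^sub>v w) = scalar_prod (H\<^sup>T *\<^sub>v v) w"
      by (rule transpose_vec_mult_scalar[OF Hc wc v, symmetric])
    then show ?thesis by (simp add: HT w_def[symmetric] vnorm_power2_scalar_prod)
  qed
  have vw: "0 \<le> scalar_prod v w"
    using order_trans[OF _ low[OF v], of 0] s by (simp add: w_def)
  \<comment> \<open>\<open>H\<^sup>2 \<preceq> smax H\<close>, obtained from \<open>0 \<preceq> H \<preceq> smax I\<close> without square roots of \<open>H\<close>\<close>
  have bound: "(vnorm w)\<^sup>2 \<le> smax * scalar_prod v w"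
  proof -
    let ?u = "smax \<cdot>\<^sub>v v - w"
    have uc: "?u \<in> carrier_vec d" using v wc by simp
    have "H *\<^sub>v ?u = smax \<cdot>\<^sub>v w - H *\<^sub>v w"
      using v wc Hc by (simp add: mult_minus_distrib_mat_vec[of _ d d] mult_mat_vec[of _ d d] w_def)
    then have "scalar_prod ?u (H *\<^sub>v ?u)
        = smax\<^sup>2 * scalar_prod v w - smax * (vnorm w)\<^sup>2 - smax * (vnorm w)\<^sup>2 + scalar_prod w (H *\<^sub>v w)"
      using v wc Hwc
      by (simp add: scalar_prod_minus_distrib[of _ d] minus_scalar_prod_distrib[of _ d] vHw
        vnorm_power2_scalar_prod[symmetric] power2_eq_square[of smax] algebra_simps)
    moreover have "0 \<le> scalar_prod ?u (H *\<^sub>v ?u)"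
      using order_trans[OF _ low[OF uc], of 0] s by simp
    ultimately have "smax * (vnorm w)\<^sup>2 \<le> smax * (smax * scalar_prod v w)"
      using up[OF wc] by (simp add: power2_eq_square algebra_simps)
    then show ?thesis using s by simp
  qed
  have vwle: "scalar_prod v w \<le> vnorm v * vnorm w"
    using abs_scalar_prod_le[of v w] v wc by simp
  have wle: "vnorm w \<le> smax * vnorm v"
  proof -
    have "vnorm w * vnorm w \<le> smax * (vnorm v * vnorm w)"
      using order_trans[OF bound mult_left_mono[OF vwle]] s by (simp add: power2_eq_square)
    then show ?thesis
      using vnorm_nonneg[of w] vnorm_nonneg[of v] s by (cases "vnorm w = 0") auto
  qed
  have "smin / smax\<^sup>2 * (vnorm w)\<^sup>2 \<le> smin / smax\<^sup>2 * (smax * vnorm v)\<^sup>2"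
    using s wle by (intro mult_left_mono power_mono) auto
  also have "\<dots> = smin * (vnorm v)\<^sup>2" using s by (simp add: power_mult_distrib)
  also have "\<dots> \<le> scalar_prod v w" using low[OF v] by (simp add: w_def)
  finally show "smin / smax\<^sup>2 * (vnorm (H *\<^sub>v v))\<^sup>2 \<le> scalar_prod v (H *\<^sub>v v)" by (simp add: w_def)
  have "smin * vnorm v * vnorm v \<le> vnorm w * vnorm v"
    using order_trans[OF low[OF v] vwle[unfolded w_def]]
    by (simp add: w_def power2_eq_square mult.commute mult.left_commute)
  then show "smin * vnorm v \<le> vnorm (H *\<^sub>v v)"
    using vnorm_nonneg[of w] vnorm_nonneg[of v] s unfolding w_def[symmetric]
    by (cases "vnorm v = 0") auto
qed

subsection \<open>Expectations over mini-batches\<close>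

lemma expectation_bind_finite:
  fixes h :: "'b \<Rightarrow> real"
  assumes "finite (set_pmf p)" "\<And>x. x \<in> set_pmf p \<Longrightarrow> finite (set_pmf (f x))"
  shows "measure_pmf.expectation (bind_pmf p f) h
    = measure_pmf.expectation p (\<lambda>x. measure_pmf.expectation (f x) h)"
  by (subst pmf_expectation_bind[OF assms(1) assms(2) order_refl], simp)
    (subst integral_measure_pmf[OF assms(1)], auto)

lemma expectation_mono_finite:
  fixes f g :: "'a \<Rightarrow> real"
  assumes "finite (set_pmf p)" "\<And>x. x \<in> set_pmf p \<Longrightarrow> f x \<le> g x"
  shows "measure_pmf.expectation p f \<le> measure_pmf.expectation p g"
  using assms by (intro integral_mono_AE integrable_measure_pmf_finite) (auto simp: AE_measure_pmf_iff)

lemma expectation_cong_set_pmf: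
  fixes f g :: "'a \<Rightarrow> real"
  assumes "\<And>x. x \<in> set_pmf p \<Longrightarrow> f x = g x"
  shows "measure_pmf.expectation p f = measure_pmf.expectation p g"
  using assms by (intro integral_cong_AE) (auto simp: AE_measure_pmf_iff)

lemma finite_set_replicate_pmf:
  assumes "finite (set_pmf p)"
  shows "finite (set_pmf (replicate_pmf b p))"
  using assms by (induction b) auto

lemma finite_set_Pi_pmf:
  assumes "finite A" "\<And>i. i \<in> A \<Longrightarrow> finite (set_pmf (p i))"
  shows "finite (set_pmf (Pi_pmf A dflt p))"
  using assms by (auto simp: set_Pi_pmf)

lemma set_Pi_pmf_upd:
  assumes "finite A" "k \<in> A" "g \<in> set_pmf (Pi_pmf (A - {k}) dflt p)" "a \<in> set_pmf (p k)"
  shows "g(k := a) \<in> set_pmf (Pi_pmf A dflt p)"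
  using assms by (auto simp: set_Pi_pmf PiE_dflt_def)

text \<open>The coordinates are independent, so coordinate \<open>k\<close> can be drawn last, after
  all the others.\<close>

lemma expectation_Pi_pmf_coordinate:
  fixes \<phi> :: "_ \<Rightarrow> real"
  assumes A: "finite A" "k \<in> A" and p: "\<And>i. i \<in> A \<Longrightarrow> finite (set_pmf (p i))"
  shows "measure_pmf.expectation (Pi_pmf A dflt p) \<phi> =
    measure_pmf.expectation (Pi_pmf (A - {k}) dflt p) (\<lambda>g.
      measure_pmf.expectation (p k) (\<lambda>a. \<phi> (g(k := a))))"
proof -
  let ?Q = "Pi_pmf (A - {k}) dflt p"
  have "Pi_pmf A dflt p = Pi_pmf (insert k (A - {k})) dflt p"
    using A by (simp add: insert_absorb)
  also have "\<dots> = do {g \<leftarrow> ?Q; a \<leftarrow> p k; return_pmf (g(k := a))}"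
    by (subst Pi_pmf_insert') (use A in \<open>auto intro: bind_commute_pmf\<close>)
  finally have "Pi_pmf A dflt p = \<dots>" .
  moreover have "finite (set_pmf ?Q)" using A p by (intro finite_set_Pi_pmf) auto
  ultimately show ?thesis
    using A p by (simp add: expectation_bind_finite)
qed

text \<open>The comparison is made after averaging over coordinate \<open>k\<close> alone. The
  families \<open>g\<close> range over the full support, where runs are specified, although their
  own value at \<open>k\<close> is overwritten.\<close>

lemma expectation_Pi_pmf_le:
  fixes \<phi> \<psi> :: "_ \<Rightarrow> real"
  assumes A: "finite A" "k \<in> A" and p: "\<And>i. i \<in> A \<Longrightarrow> finite (set_pmf (p i))"
    and le: "\<And>g. g \<in> set_pmf (Pi_pmf A dflt p) \<Longrightarrow>
      measure_pmf.expectation (p k) (\<lambda>a. \<phi> (g(k := a)))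
      \<le> measure_pmf.expectation (p k) (\<lambda>a. \<psi> (g(k := a)))"
  shows "measure_pmf.expectation (Pi_pmf A dflt p) \<phi> \<le> measure_pmf.expectation (Pi_pmf A dflt p) \<psi>"
proof -
  have "measure_pmf.expectation (p k) (\<lambda>a. \<phi> (g(k := a)))
      \<le> measure_pmf.expectation (p k) (\<lambda>a. \<psi> (g(k := a)))"
    if g: "g \<in> set_pmf (Pi_pmf (A - {k}) dflt p)" for g
  proof -
    \<comment> \<open>Any admissible value completes the partial family to one in the full support;
      the update in both integrands erases it again.\<close>
    obtain a where "a \<in> set_pmf (p k)" using set_pmf_not_empty[of "p k"] by blast
    from le[OF set_Pi_pmf_upd[OF A g this]] show ?thesis by simp
  qed
  then show ?thesis
    unfolding expectation_Pi_pmf_coordinate[where p=p and dflt=dflt, OF A p, simplified]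
    by (rule expectation_mono_finite[rotated]) (use A p in \<open>auto intro: finite_set_Pi_pmf\<close>)
qed

section \<open>Second moments of mini-batch sums\<close>

text \<open>Independent centred draws have no cross terms, so their second moments add. The offset
  \<open>c\<close> stays arbitrary so that the induction can absorb the first draw into it.\<close>

lemma replicate_pmf_second_moment:
  fixes h :: "nat \<Rightarrow> real"
  assumes n: "n \<ge> 1" and h: "(\<Sum>i=1..n. h i) = 0"
  shows "measure_pmf.expectation (replicate_pmf b (pmf_of_set {1..n}))
      (\<lambda>is. (c + (\<Sum>i\<leftarrow>is. h i))\<^sup>2) = c\<^sup>2 + real b * ((\<Sum>i=1..n. (h i)\<^sup>2) / real n)"
proof (induction b arbitrary: c)
  case 0
  then show ?case by simp
next
  case (Suc b)
  let ?U = "pmf_of_set {1..n}" and ?V = "(\<Sum>i=1..n. (h i)\<^sup>2) / real n"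
  have ne: "{1..n} \<noteq> {}" using n by auto
  have fin: "finite (set_pmf ?U)" using n by (subst set_pmf_of_set) auto
  have "measure_pmf.expectation (replicate_pmf (Suc b) ?U) (\<lambda>is. (c + (\<Sum>i\<leftarrow>is. h i))\<^sup>2)
      = measure_pmf.expectation ?U (\<lambda>i. measure_pmf.expectation (replicate_pmf b ?U)
          (\<lambda>is. ((c + h i) + (\<Sum>i\<leftarrow>is. h i))\<^sup>2))"
    using fin by (simp add: expectation_bind_finite finite_set_replicate_pmf add.assoc)
  also have "\<dots> = measure_pmf.expectation ?U (\<lambda>i. (c + h i)\<^sup>2 + real b * ?V)"
    by (simp only: Suc.IH)
  also have "\<dots> = (\<Sum>i=1..n. (c + h i)\<^sup>2 + real b * ?V) / real n"
    using ne by (subst integral_pmf_of_set) auto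
  also have "(\<Sum>i=1..n. (c + h i)\<^sup>2 + real b * ?V)
      = real n * c\<^sup>2 + 2 * c * (\<Sum>i=1..n. h i) + (\<Sum>i=1..n. (h i)\<^sup>2) + real n * (real b * ?V)"
    by (simp add: power2_sum sum.distrib sum_distrib_left algebra_simps)
  also have "\<dots> / real n = c\<^sup>2 + real (Suc b) * ?V"
    unfolding h using n by (simp add: add_divide_distrib algebra_simps)
  finally show ?case .
qed

text \<open>In the application, \<open>e\<close> is the error inherited from the previous iteration
  and \<open>\<Delta> i j\<close> is coordinate \<open>j\<close> of the gradient change of component
  \<open>i\<close>. The sampling noise is centred, hence uncorrelated with \<open>e\<close>, and its
  variance is at most the mean second moment divided by \<open>b\<close>.\<close>

lemma minibatch_variance_le:
  fixes \<Delta> :: "nat \<Rightarrow> nat \<Rightarrow> real"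
  assumes n: "n \<ge> 1" and b: "b \<ge> 1"
  shows "measure_pmf.expectation (replicate_pmf b (pmf_of_set {1..n}))
      (\<lambda>is. \<Sum>j<d. (e j + ((\<Sum>i\<leftarrow>is. \<Delta> i j) / real (length is) - (\<Sum>i=1..n. \<Delta> i j) / real n))\<^sup>2)
    \<le> (\<Sum>j<d. (e j)\<^sup>2) + (\<Sum>i=1..n. \<Sum>j<d. (\<Delta> i j)\<^sup>2) / real n / real b"
proof -
  let ?R = "replicate_pmf b (pmf_of_set {1..n})"
  define \<mu> where "\<mu> j = (\<Sum>i=1..n. \<Delta> i j) / real n" for j
  \<comment> \<open>Centred and divided by \<open>b\<close>, so that the deviation of the batch mean
    is the plain sum of \<open>h j\<close> over the batch.\<close>
  define h where "h j i = (\<Delta> i j - \<mu> j) / real b" for i j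
  have fin: "finite (set_pmf ?R)"
    using n by (intro finite_set_replicate_pmf) (subst set_pmf_of_set, auto)
  have h0: "(\<Sum>i=1..n. h j i) = 0" for j
    using n by (simp add: h_def \<mu>_def sum_divide_distrib[symmetric] sum_subtractf)
  have hsum: "(\<Sum>i\<leftarrow>is. h j i) = (\<Sum>i\<leftarrow>is. \<Delta> i j) / real b - real (length is) * \<mu> j / real b" for j "is"
    by (induction "is") (simp_all add: h_def diff_divide_distrib add_divide_distrib distrib_right)
  have hsq: "(\<Sum>i=1..n. (h j i)\<^sup>2) \<le> (\<Sum>i=1..n. (\<Delta> i j)\<^sup>2) / (real b)\<^sup>2" for j
  proof -
    have "(\<Sum>i=1..n. (\<Delta> i j - \<mu> j)\<^sup>2)
        = (\<Sum>i=1..n. (\<Delta> i j)\<^sup>2) - 2 * \<mu> j * (\<Sum>i=1..n. \<Delta> i j) + real n * (\<mu> j)\<^sup>2"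
      by (simp add: power2_diff sum.distrib sum_subtractf sum_distrib_left algebra_simps)
    also have "(\<Sum>i=1..n. \<Delta> i j) = real n * \<mu> j" using n by (simp add: \<mu>_def)
    finally have "(\<Sum>i=1..n. (\<Delta> i j - \<mu> j)\<^sup>2) = (\<Sum>i=1..n. (\<Delta> i j)\<^sup>2) - real n * (\<mu> j)\<^sup>2"
      by (simp add: power2_eq_square)
    then have "(\<Sum>i=1..n. (\<Delta> i j - \<mu> j)\<^sup>2) \<le> (\<Sum>i=1..n. (\<Delta> i j)\<^sup>2)" by simp
    then show ?thesis
      by (simp add: h_def power_divide sum_divide_distrib[symmetric] divide_right_mono)
  qed
  \<comment> \<open>Every batch in the support has length exactly \<open>b\<close>, which identifies
    the two integrands there.\<close>
  have "measure_pmf.expectation ?R (\<lambda>is. \<Sum>j<d.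
        (e j + ((\<Sum>i\<leftarrow>is. \<Delta> i j) / real (length is) - \<mu> j))\<^sup>2)
      = measure_pmf.expectation ?R (\<lambda>is. \<Sum>j<d. (e j + (\<Sum>i\<leftarrow>is. h j i))\<^sup>2)"
    using b by (intro expectation_cong_set_pmf sum.cong) (auto simp: set_replicate_pmf hsum)
  also have "\<dots> = (\<Sum>j<d. measure_pmf.expectation ?R (\<lambda>is. (e j + (\<Sum>i\<leftarrow>is. h j i))\<^sup>2))"
    by (intro Bochner_Integration.integral_sum integrable_measure_pmf_finite fin)
  also have "\<dots> = (\<Sum>j<d. (e j)\<^sup>2 + real b * ((\<Sum>i=1..n. (h j i)\<^sup>2) / real n))"
    by (simp only: replicate_pmf_second_moment[OF n h0])
  also have "\<dots> \<le> (\<Sum>j<d. (e j)\<^sup>2 + real b * ((\<Sum>i=1..n. (\<Delta> i j)\<^sup>2) / (real b)\<^sup>2 / real n))"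
    by (intro sum_mono add_left_mono mult_left_mono divide_right_mono hsq) auto
  also have "\<dots> = (\<Sum>j<d. (e j)\<^sup>2 + (\<Sum>i=1..n. (\<Delta> i j)\<^sup>2) / real n / real b)"
    using b by (intro sum.cong refl) (simp add: power2_eq_square)
  also have "\<dots> = (\<Sum>j<d. (e j)\<^sup>2) + (\<Sum>j<d. (\<Sum>i=1..n. (\<Delta> i j)\<^sup>2)) / real n / real b"
    by (simp only: sum.distrib sum_divide_distrib)
  also have "(\<Sum>j<d. (\<Sum>i=1..n. (\<Delta> i j)\<^sup>2)) = (\<Sum>i=1..n. \<Sum>j<d. (\<Delta> i j)\<^sup>2)"
    by (rule sum.swap)
  finally show ?thesis by (simp add: \<mu>_def)
qed

subsection \<open>Scalar recursions\<close>

text \<open>\<open>B k\<close> is a price for one unit of \<open>p k\<close>: it covers the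
  immediate cost \<open>c k\<close> and the price of the fraction \<open>\<tau> k\<close> passed on.
  The costs then telescope, with each new input \<open>r k\<close> charged at
  \<open>B (Suc k)\<close>.\<close>

lemma potential_sum_le:
  fixes p r c B \<tau> :: "nat \<Rightarrow> real"
  assumes p: "p 0 = 0" "\<And>k. p k \<ge> 0" and B: "\<And>k. B k \<ge> 0"
    and step: "\<And>k. k < K \<Longrightarrow> p (Suc k) \<le> \<tau> k * p k + r k"
    and pot: "\<And>k. c k + B (Suc k) * \<tau> k \<le> B k"
  shows "(\<Sum>k<K. c k * p k) \<le> (\<Sum>k<K. B (Suc k) * r k)"
proof -
  have "(\<Sum>k<N. c k * p k) + B N * p N \<le> (\<Sum>k<N. B (Suc k) * r k)" if "N \<le> K" for N
    using that
  proof (induction N)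
    case 0
    then show ?case using p by simp
  next
    case (Suc N)
    have "c N * p N + B (Suc N) * p (Suc N) \<le> c N * p N + B (Suc N) * (\<tau> N * p N + r N)"
      using step[of N] B[of "Suc N"] Suc.prems by (simp add: mult_left_mono)
    also have "\<dots> = (c N + B (Suc N) * \<tau> N) * p N + B (Suc N) * r N"
      by (simp add: algebra_simps)
    also have "\<dots> \<le> B N * p N + B (Suc N) * r N"
      using pot[of N] p(2)[of N] by (simp add: mult_right_mono)
    finally show ?case using Suc by simp
  qed
  from this[of K] show ?thesis using B[of K] p(2)[of K]
    by (smt (verit) mult_nonneg_nonneg order_refl)
qed

text \<open>The first weight measures the distance from \<open>z\<close> to \<open>x\<close>, the
  second the part of the movement of \<open>z\<close> caused by momentum. The second bound keeps
  \<open>\<mu>\<close> itself, because the later step-size estimate uses its exact quadratic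
  dependence.\<close>

lemma momentum_gap_sum:
  fixes p D \<mu> :: "nat \<Rightarrow> real"
  assumes p: "p 0 = 0" "\<And>k. p k \<ge> 0"
    and D: "\<And>k. D k \<ge> 0" and \<mu>: "\<And>k. k < K \<Longrightarrow> 0 \<le> \<mu> k \<and> \<mu> k \<le> 2 / (real k + 1) * \<beta>"
    and step: "\<And>k. k < K \<Longrightarrow>
       p (Suc k) \<le> (1 - 2 / (real k + 2)) * p k + (\<mu> k)\<^sup>2 * (real k + 2) / 2 * D k"
  shows "(\<Sum>k<K. (1 - 2 / (real k + 2))\<^sup>2 * p k) \<le> (\<Sum>k<K. 3 * \<beta>\<^sup>2 * D k)"
    and "(\<Sum>k<K. (2 / (real k + 2))\<^sup>2 * p k) \<le> (\<Sum>k<K. (\<mu> k)\<^sup>2 * D k)"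
proof -
  \<comment> \<open>with \<open>\<Gamma>\<^sub>k = 2 / (k (k + 1))\<close>, this \<open>B k\<close> dominates \<open>\<Sum>\<^bsub>i\<ge>k\<^esub> (1 - \<alpha>\<^bsub>i+1\<^esub>)\<^sup>2 \<Gamma>\<^sub>i / \<Gamma>\<^sub>k\<close>, the total weight
    that a unit of \<open>p k\<close> contributes from step \<open>k\<close> on\<close>
  define B where "B k = real k * (real k + 1) / (real k + 2)" for k
  have "(\<Sum>k<K. (1 - 2 / (real k + 2))\<^sup>2 * p k)
      \<le> (\<Sum>k<K. B (Suc k) * ((\<mu> k)\<^sup>2 * (real k + 2) / 2 * D k))"
  proof (rule potential_sum_le[OF p _ step])
    show "(1 - 2 / (real k + 2))\<^sup>2 + B (Suc k) * (1 - 2 / (real k + 2)) \<le> B k" for k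
    proof -
      have "B k - (1 - 2 / (real k + 2))\<^sup>2 - B (Suc k) * (1 - 2 / (real k + 2))
          = 2 * real k / ((real k + 2)\<^sup>2 * (real k + 3))"
      proof -
        have B': "B (Suc k) = (real k + 1) * (real k + 2) / (real k + 3)" by (simp add: B_def algebra_simps)
        show ?thesis unfolding B' unfolding B_def
          by (simp add: divide_simps) (simp add: power2_eq_square algebra_simps)
      qed
      moreover have "0 \<le> 2 * real k / ((real k + 2)\<^sup>2 * (real k + 3))" by simp
      ultimately show ?thesis by linarith
    qed
  qed (simp_all add: B_def)
  also have "\<dots> \<le> (\<Sum>k<K. 3 * \<beta>\<^sup>2 * D k)"
  proof (rule sum_mono)
    fix k assume k: "k \<in> {..<K}"
    have "(\<mu> k)\<^sup>2 \<le> (2 / (real k + 1) * \<beta>)\<^sup>2" using \<mu>[of k] k by (intro power_mono) auto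
    then have "B (Suc k) * ((\<mu> k)\<^sup>2 * (real k + 2) / 2)
        \<le> B (Suc k) * ((2 / (real k + 1) * \<beta>)\<^sup>2 * (real k + 2) / 2)"
      by (intro mult_left_mono divide_right_mono mult_right_mono) (auto simp: B_def)
    also have "\<dots> = 2 * (real k + 2)\<^sup>2 / ((real k + 1) * (real k + 3)) * \<beta>\<^sup>2"
    proof -
      have B': "B (Suc k) = (real k + 1) * (real k + 2) / (real k + 3)"
        by (simp add: B_def algebra_simps)
      show ?thesis unfolding B'
        by (simp add: divide_simps) (simp add: power2_eq_square algebra_simps)
    qed
    \<comment> \<open>Since \<open>(k + 2)\<^sup>2 = (k + 1) * (k + 3) + 1\<close>, the factor is at
      most 8/3, attained at \<open>k = 0\<close>.\<close>
    also have "\<dots> \<le> 3 * \<beta>\<^sup>2"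
      by (intro mult_right_mono) (auto simp: divide_simps power2_eq_square algebra_simps)
    finally have "B (Suc k) * ((\<mu> k)\<^sup>2 * (real k + 2) / 2) * D k \<le> 3 * \<beta>\<^sup>2 * D k"
      using D[of k] by (rule mult_right_mono)
    then show "B (Suc k) * ((\<mu> k)\<^sup>2 * (real k + 2) / 2 * D k) \<le> 3 * \<beta>\<^sup>2 * D k"
      by (simp add: mult.assoc)
  qed
  finally show "(\<Sum>k<K. (1 - 2 / (real k + 2))\<^sup>2 * p k) \<le> (\<Sum>k<K. 3 * \<beta>\<^sup>2 * D k)" .
next
  \<comment> \<open>For the small weights this price suffices, with the same slack as before;
    \<open>B (Suc k)\<close> almost cancels the factor \<open>(k + 2) / 2\<close> of the
    input.\<close>
  define B where "B k = 2 / (real k + 2)" for k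
  have "(\<Sum>k<K. (2 / (real k + 2))\<^sup>2 * p k)
      \<le> (\<Sum>k<K. B (Suc k) * ((\<mu> k)\<^sup>2 * (real k + 2) / 2 * D k))"
  proof (rule potential_sum_le[OF p _ step])
    show "(2 / (real k + 2))\<^sup>2 + B (Suc k) * (1 - 2 / (real k + 2)) \<le> B k" for k
    proof -
      have "B k - (2 / (real k + 2))\<^sup>2 - B (Suc k) * (1 - 2 / (real k + 2))
          = 2 * real k / ((real k + 2)\<^sup>2 * (real k + 3))"
      proof -
        have B': "B (Suc k) = 2 / (real k + 3)" by (simp add: B_def algebra_simps)
        show ?thesis unfolding B' unfolding B_def
          by (simp add: divide_simps) (simp add: power2_eq_square algebra_simps)
      qed
      moreover have "0 \<le> 2 * real k / ((real k + 2)\<^sup>2 * (real k + 3))" by simp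
      ultimately show ?thesis by linarith
    qed
  qed (simp_all add: B_def)
  also have "\<dots> \<le> (\<Sum>k<K. (\<mu> k)\<^sup>2 * D k)"
  proof (rule sum_mono)
    fix k
    have "B (Suc k) * ((\<mu> k)\<^sup>2 * (real k + 2) / 2 * D k)
        = (real k + 2) / (real k + 3) * ((\<mu> k)\<^sup>2 * D k)"
      by (simp add: B_def field_simps)
    also have "\<dots> \<le> 1 * ((\<mu> k)\<^sup>2 * D k)" using D[of k] by (intro mult_right_mono) auto
    finally show "B (Suc k) * ((\<mu> k)\<^sup>2 * (real k + 2) / 2 * D k) \<le> (\<mu> k)\<^sup>2 * D k" by simp
  qed
  finally show "(\<Sum>k<K. (2 / (real k + 2))\<^sup>2 * p k) \<le> (\<Sum>k<K. (\<mu> k)\<^sup>2 * D k)" .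
qed

text \<open>This is the total coefficient of a squared direction: descent, estimator error and
  momentum gap. With \<open>\<eta> = (1 + u) * \<beta>\<close> and \<open>sqrt 15 \<ge> 3.8\<close>,
  it is negative on the whole range of \<open>u\<close> from 0 to 2.\<close>

lemma step_coefficient_le:
  fixes a L \<beta> \<eta> :: real
  assumes a: "a > 0" and L: "L > 0" and \<beta>: "\<beta> = a / ((3 + sqrt 15) * L)"
    and \<eta>: "\<beta> \<le> \<eta>" "\<eta> \<le> 3 * \<beta>"
  shows "- \<eta> * a + 3 / 2 * L * \<eta>\<^sup>2 + L * (\<beta>\<^sup>2 + (\<eta> - \<beta>)\<^sup>2) + 3 / 2 * L * \<beta>\<^sup>2 \<le> - a * \<beta> / 20"
proof -
  have s: "sqrt 15 \<ge> 38 / 10" by (rule real_le_rsqrt) (simp add: power2_eq_square)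
  have pos: "3 + sqrt 15 > 0" using s by linarith
  then have \<beta>0: "\<beta> > 0" using a L by (simp add: \<beta>)
  have ab: "a = (3 + sqrt 15) * (L * \<beta>)" using pos L by (simp add: \<beta>)
  have "(68 / 10) * (L * \<beta>) \<le> a" unfolding ab using s L \<beta>0 by (intro mult_right_mono) auto
  then have Lb: "L * \<beta> \<le> 10 / 68 * a" by simp
  define u where "u = \<eta> / \<beta> - 1"
  have lu: "\<eta> = (1 + u) * \<beta>" using \<beta>0 by (simp add: u_def)
  have u: "0 \<le> u" "u \<le> 2" using \<eta> \<beta>0 by (auto simp: u_def field_simps)
  let ?P = "3 / 2 * (1 + u)\<^sup>2 + 1 + u\<^sup>2 + 3 / 2"
  \<comment> \<open>The convex quadratic \<open>?P\<close> is replaced by its chord on the interval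
    from 0 to 2. What remains is affine in \<open>u\<close>, with worst value -1/17 at
    \<open>u = 2\<close>, below the claimed -1/20.\<close>
  have "u\<^sup>2 \<le> 2 * u" using u by (simp add: power2_eq_square mult_right_mono)
  then have P: "?P \<le> 4 + 8 * u" by (simp add: power2_eq_square algebra_simps)
  have "- \<eta> * a + 3 / 2 * L * \<eta>\<^sup>2 + L * (\<beta>\<^sup>2 + (\<eta> - \<beta>)\<^sup>2) + 3 / 2 * L * \<beta>\<^sup>2
      = \<beta> * (- (1 + u) * a + (L * \<beta>) * ?P)"
    unfolding lu by (simp add: power2_eq_square algebra_simps)
  also have "\<dots> \<le> \<beta> * (- (1 + u) * a + (10 / 68 * a) * (4 + 8 * u))"
    using \<beta>0 Lb P L a u by (intro mult_left_mono[of _ _ \<beta>] add_left_mono mult_mono[of "L * \<beta>"]) auto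
  also have "\<dots> \<le> \<beta> * (- a / 20)"
  proof (rule mult_left_mono)
    have "- (1 + u) + 10 / 68 * (4 + 8 * u) = 3 / 17 * u - 7 / 17"
      by (simp add: algebra_simps)
    then have "- (1 + u) + 10 / 68 * (4 + 8 * u) \<le> - (1 / 20)" using u by simp
    then have "a * (- (1 + u) + 10 / 68 * (4 + 8 * u)) \<le> a * (- (1 / 20))"
      using a by (intro mult_left_mono) auto
    then show "- (1 + u) * a + (10 / 68 * a) * (4 + 8 * u) \<le> - a / 20"
      by (simp add: algebra_simps)
  qed (use \<beta>0 in simp)
  finally show ?thesis by (simp add: mult.commute)
qed

text \<open>An increment \<open>G k / q\<close> persists only until the next refresh, hence in fewer
  than \<open>q\<close> errors; the epoch length cancels the \<open>1/q\<close>.\<close>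

lemma epoch_error_sum:
  fixes E G :: "nat \<Rightarrow> real"
  assumes q: "q \<ge> 1" and E0: "\<And>k. k < K \<Longrightarrow> k mod q = 0 \<Longrightarrow> E k = 0" and E: "\<And>k. E k \<ge> 0"
    and G: "\<And>k. G k \<ge> 0"
    and step: "\<And>k. k < K \<Longrightarrow> k mod q \<noteq> 0 \<Longrightarrow> E k \<le> E (k - 1) + G k / real q"
  shows "(\<Sum>k<K. E k) \<le> (\<Sum>k\<in>{1..<K}. G k)"
proof (cases "K = 0")
  case False
  \<comment> \<open>The second summand is a reserve: it pays for carrying the present error through
    the rest of the epoch.\<close>
  have "(\<Sum>j\<le>k. E j) + (real q - 1 - real (k mod q)) * E k \<le> (\<Sum>j\<in>{1..k}. G j)" if "k < K" for k
    using that
  proof (induction k)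
    case 0
    then show ?case using E0[of 0] by simp
  next
    case (Suc k)
    let ?m = "real q - 1 - real (k mod q)"
    have kq: "k mod q < q" using q by simp
    then have m: "0 \<le> ?m" "?m \<le> real q" by linarith+
    show ?case
    proof (cases "Suc k mod q = 0")
      case True
      have "Suc (k mod q) = q"
        using True by (simp add: mod_Suc split: if_splits)
      \<comment> \<open>At the end of an epoch the reserve is used up, and the refresh resets the
        error to 0.\<close>
      then have "?m = 0" by linarith
      then show ?thesis using Suc True E0[of "Suc k"] G[of "Suc k"] by simp
    next
      case False
      have "Suc k mod q = Suc (k mod q)" using False by (simp add: mod_Suc split: if_splits)
      then have "(\<Sum>j\<le>Suc k. E j) + (real q - 1 - real (Suc k mod q)) * E (Suc k)
          = (\<Sum>j\<le>k. E j) + ?m * E (Suc k)"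
        by (simp add: algebra_simps)
      also have "\<dots> \<le> (\<Sum>j\<le>k. E j) + ?m * (E k + G (Suc k) / real q)"
        using step[of "Suc k"] Suc.prems False m by (intro add_left_mono mult_left_mono) auto
      also have "\<dots> = (\<Sum>j\<le>k. E j) + ?m * E k + ?m / real q * G (Suc k)"
        by (simp add: distrib_left)
      also have "\<dots> \<le> (\<Sum>j\<in>{1..k}. G j) + 1 * G (Suc k)"
        using Suc m G[of "Suc k"] q by (intro add_mono mult_right_mono) auto
      finally show ?thesis by simp
    qed
  qed
  from this[of "K - 1"] False have "(\<Sum>j\<le>K - 1. E j) + (real q - 1 - real ((K - 1) mod q)) * E (K - 1)
      \<le> (\<Sum>j\<in>{1..K - 1}. G j)" by simp
  moreover have "{..K - 1} = {..<K}" "{1..K - 1} = {1..<K}" using False by auto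
  moreover have "0 \<le> (real q - 1 - real ((K - 1) mod q)) * E (K - 1)"
  proof (rule mult_nonneg_nonneg)
    have "(K - 1) mod q < q" using q by simp
    then show "0 \<le> real q - 1 - real ((K - 1) mod q)" by linarith
  qed (rule E)
  ultimately show ?thesis by simp
qed simp

subsection \<open>Single steps of a run\<close>

text \<open>The newest pair used has index \<open>k - 1\<close>, so nothing of the sequences beyond
  index \<open>k\<close> is read.\<close>

lemma sd_lbfgs_cong:
  assumes x: "\<And>i. i \<le> k \<Longrightarrow> x i = x' i" and v: "\<And>i. i \<le> k \<Longrightarrow> v i = v' i"
  shows "sd_lbfgs d m \<delta> g0 x v k = sd_lbfgs d m \<delta> g0 x' v' k"
proof -
  have s: "pair_s x j = pair_s x' j" and y: "pair_y v j = pair_y v' j" if "j < k" for j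
    using x[of j] x[of "j + 1"] v[of j] v[of "j + 1"] that by (simp_all add: pair_s_def pair_y_def)
  have g: "sd_gamma \<delta> g0 x v j = sd_gamma \<delta> g0 x' v' j" if "j \<le> k" for j
    using s[of "j - 1"] y[of "j - 1"] that by (simp add: sd_gamma_def)
  have yh: "sd_y_hat d \<delta> g0 x v j = sd_y_hat d \<delta> g0 x' v' j" if "j < k" for j
    using s[OF that] y[OF that] g[of "j + 1"] that by (simp add: sd_y_hat_def)
  show ?thesis
    unfolding sd_lbfgs_def g[OF order_refl]
    by (rule fold_cong) (auto simp: s yh)
qed

text \<open>Causality: batches below \<open>N\<close> fix \<open>x\<close> and \<open>y\<close> up
  to \<open>N\<close>, but \<open>z\<close> and \<open>v\<close> only below \<open>N\<close>. This
  justifies redrawing one batch while the past stays frozen.\<close>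

lemma spider_run_prefix:
  assumes run: "spider_sqn_m_run d n f q m \<delta> g0 \<alpha> \<beta> \<Lambda> K x0 \<xi> x y z v H"
    and run': "spider_sqn_m_run d n f q m \<delta> g0 \<alpha> \<beta> \<Lambda> K x0 \<xi>' x' y' z' v' H'"
    and eq: "\<And>i. i < N \<Longrightarrow> \<xi> i = \<xi>' i" and N: "N \<le> K"
  shows "(\<forall>i\<le>N. x i = x' i \<and> y i = y' i) \<and> (\<forall>i<N. z i = z' i \<and> v i = v' i)"
  using eq N
proof (induction N)
  case 0
  then show ?case using run run' by (simp add: spider_sqn_m_run_def)
next
  case (Suc N)
  have N: "N < K" using Suc.prems by simp
  have IHx: "\<And>i. i \<le> N \<Longrightarrow> x i = x' i" and IHy: "y N = y' N"
    and IHz: "\<And>i. i < N \<Longrightarrow> z i = z' i" and IHv: "\<And>i. i < N \<Longrightarrow> v i = v' i"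
    using Suc by auto
  have z: "z N = z' N"
    using run run' N IHx[of N] IHy by (simp add: spider_sqn_m_run_def)
  have v: "v N = v' N"
  proof (cases "N mod q = 0")
    case True
    then show ?thesis using run run' N z by (simp add: spider_sqn_m_run_def)
  next
    case False
    then have "N - 1 < N" by (cases N) auto
    then show ?thesis
      using run run' N z False IHz[of "N - 1"] IHv[of "N - 1"] Suc.prems(1)[of N]
      by (simp add: spider_sqn_m_run_def)
  qed
  have v': "v i = v' i" if "i \<le> N" for i
    using that v IHv[of i] by (cases "i = N") auto
  have H: "H N = H' N"
    using run run' N sd_lbfgs_cong[of N x x' v v' d m \<delta> g0, OF IHx v']
    by (simp add: spider_sqn_m_run_def)
  have "x (Suc N) = x' (Suc N)" "y (Suc N) = y' (Suc N)"
    using run run' N z v H IHx[of N] by (simp_all add: spider_sqn_m_run_def)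
  then show ?case using IHx Suc z v by (auto simp: le_Suc_eq less_Suc_eq)
qed

section \<open>Inequalities for one iteration\<close>

text \<open>Convexity of the square at the points \<open>w\<close> and
  \<open>- \<mu> * g / t\<close> with weights \<open>1 - t\<close> and \<open>t\<close>; the slack
  is an explicit square.\<close>

lemma convex_combination_power2_le:
  fixes w g t \<mu> :: real
  assumes "0 < t" "t \<le> 1"
  shows "((1 - t) * w - \<mu> * g)\<^sup>2 \<le> (1 - t) * w\<^sup>2 + \<mu>\<^sup>2 / t * g\<^sup>2"
proof -
  have "(1 - t) * w\<^sup>2 + \<mu>\<^sup>2 / t * g\<^sup>2 - ((1 - t) * w - \<mu> * g)\<^sup>2 = (1 - t) / t * (t * w + \<mu> * g)\<^sup>2"
    using assms by (simp add: field_simps power2_eq_square)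
  moreover have "0 \<le> (1 - t) / t * (t * w + \<mu> * g)\<^sup>2" using assms by simp
  ultimately show ?thesis by linarith
qed

lemma power2_sum_le: "(a + b)\<^sup>2 \<le> 2 * a\<^sup>2 + 2 * b\<^sup>2" for a b :: real
  using zero_le_power2[of "a - b"] by (simp add: power2_eq_square algebra_simps)

lemma young_scaled:
  fixes s t \<eta> L :: real
  assumes "L > 0"
  shows "\<eta> * (s * t) \<le> s\<^sup>2 / (2 * L) + L / 2 * \<eta>\<^sup>2 * t\<^sup>2"
proof -
  have "s\<^sup>2 / (2 * L) + L / 2 * \<eta>\<^sup>2 * t\<^sup>2 - \<eta> * (s * t) = (s - L * \<eta> * t)\<^sup>2 / (2 * L)"
    using assms by (simp add: field_simps power2_eq_square)
  moreover have "0 \<le> (s - L * \<eta> * t)\<^sup>2 / (2 * L)" using assms by simp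
  ultimately show ?thesis by linarith
qed

text \<open>The gradient at \<open>x\<close> is split as \<open>v\<close> minus the estimator error
  at \<open>z\<close> minus the gradient change from \<open>x\<close> to \<open>z\<close>. Each of
  the two corrections costs \<open>L / 2 * \<eta>\<^sup>2\<close> by Young's inequality; with the
  quadratic term of the descent lemma this makes 3/2.\<close>

lemma step_descent:
  assumes F: "L_smooth d L F" and L: "L > 0" and \<eta>: "\<eta> \<ge> 0"
    and c: "x \<in> carrier_vec d" "z \<in> carrier_vec d" "v \<in> carrier_vec d" "g \<in> carrier_vec d"
    and curv: "a * (vnorm g)\<^sup>2 \<le> scalar_prod v g"
  shows "F (x - \<eta> \<cdot>\<^sub>v g) \<le> F x + (- \<eta> * a + 3 / 2 * L * \<eta>\<^sup>2) * (vnorm g)\<^sup>2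
    + (vnorm (v - grad d F z))\<^sup>2 / (2 * L) + L / 2 * (vnorm (z - x))\<^sup>2"
proof -
  have diff: "differentiable_Rd d F" using F by (simp add: L_smooth_def)
  let ?Gx = "grad d F x" and ?Gz = "grad d F z"
  have G: "?Gx \<in> carrier_vec d" "?Gz \<in> carrier_vec d" using grad_carrier[OF diff] c by auto
  have h: "x - \<eta> \<cdot>\<^sub>v g = x + (- \<eta>) \<cdot>\<^sub>v g" using c by (intro eq_vecI) auto
  have "F (x - \<eta> \<cdot>\<^sub>v g) \<le> F x + scalar_prod ?Gx ((- \<eta>) \<cdot>\<^sub>v g) + L / 2 * (vnorm ((- \<eta>) \<cdot>\<^sub>v g))\<^sup>2"
    unfolding h using c by (intro L_smooth_descent[OF F]) auto
  also have "scalar_prod ?Gx ((- \<eta>) \<cdot>\<^sub>v g) = - \<eta> * scalar_prod ?Gx g"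
    using c G by (intro scalar_prod_smult_distrib[of _ d]) auto
  also have "vnorm ((- \<eta>) \<cdot>\<^sub>v g) = \<eta> * vnorm g" using \<eta> by (simp add: vnorm_smult)
  finally have main: "F (x - \<eta> \<cdot>\<^sub>v g) \<le> F x - \<eta> * scalar_prod ?Gx g + L / 2 * \<eta>\<^sup>2 * (vnorm g)\<^sup>2"
    by (simp add: power_mult_distrib)
  have split: "scalar_prod ?Gx g = scalar_prod v g - scalar_prod (v - ?Gz) g - scalar_prod (?Gz - ?Gx) g"
    using c G by (simp add: minus_scalar_prod_distrib[of _ d])
  have "\<eta> * scalar_prod (v - ?Gz) g \<le> \<eta> * (vnorm (v - ?Gz) * vnorm g)"
    using abs_scalar_prod_le[of "v - ?Gz" g] c G \<eta> by (intro mult_left_mono) auto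
  also have "\<dots> \<le> (vnorm (v - ?Gz))\<^sup>2 / (2 * L) + L / 2 * \<eta>\<^sup>2 * (vnorm g)\<^sup>2"
    by (rule young_scaled[OF L])
  finally have y1: "\<eta> * scalar_prod (v - ?Gz) g
    \<le> (vnorm (v - ?Gz))\<^sup>2 / (2 * L) + L / 2 * \<eta>\<^sup>2 * (vnorm g)\<^sup>2" .
  have "scalar_prod (?Gz - ?Gx) g \<le> vnorm (?Gz - ?Gx) * vnorm g"
    using abs_scalar_prod_le[of "?Gz - ?Gx" g] c G by auto
  also have "\<dots> \<le> L * vnorm (z - x) * vnorm g"
    using F c by (intro mult_right_mono) (auto simp: L_smooth_def)
  finally have "\<eta> * scalar_prod (?Gz - ?Gx) g \<le> \<eta> * (L * vnorm (z - x) * vnorm g)"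
    using \<eta> by (rule mult_left_mono)
  also have "\<dots> \<le> (L * vnorm (z - x))\<^sup>2 / (2 * L) + L / 2 * \<eta>\<^sup>2 * (vnorm g)\<^sup>2"
    by (rule young_scaled[OF L])
  also have "(L * vnorm (z - x))\<^sup>2 / (2 * L) = L / 2 * (vnorm (z - x))\<^sup>2"
    using L by (simp add: power2_eq_square)
  finally have y2: "\<eta> * scalar_prod (?Gz - ?Gx) g
    \<le> L / 2 * (vnorm (z - x))\<^sup>2 + L / 2 * \<eta>\<^sup>2 * (vnorm g)\<^sup>2" .
  have "\<eta> * (a * (vnorm g)\<^sup>2) \<le> \<eta> * scalar_prod v g" using curv \<eta> by (rule mult_left_mono)
  then have "- \<eta> * scalar_prod ?Gx g \<le> - (\<eta> * (a * (vnorm g)\<^sup>2))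
      + ((vnorm (v - ?Gz))\<^sup>2 / (2 * L) + L / 2 * \<eta>\<^sup>2 * (vnorm g)\<^sup>2)
      + (L / 2 * (vnorm (z - x))\<^sup>2 + L / 2 * \<eta>\<^sup>2 * (vnorm g)\<^sup>2)"
    using y1 y2 unfolding split by (simp add: right_diff_distrib)
  then have "F (x - \<eta> \<cdot>\<^sub>v g) \<le> F x + (- (\<eta> * (a * (vnorm g)\<^sup>2))
      + ((vnorm (v - ?Gz))\<^sup>2 / (2 * L) + L / 2 * \<eta>\<^sup>2 * (vnorm g)\<^sup>2)
      + (L / 2 * (vnorm (z - x))\<^sup>2 + L / 2 * \<eta>\<^sup>2 * (vnorm g)\<^sup>2)) + L / 2 * \<eta>\<^sup>2 * (vnorm g)\<^sup>2"
    using main by linarith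
  also have "\<dots> = F x + (- \<eta> * a + 3 / 2 * L * \<eta>\<^sup>2) * (vnorm g)\<^sup>2
    + (vnorm (v - grad d F z))\<^sup>2 / (2 * L) + L / 2 * (vnorm (z - x))\<^sup>2"
    by (simp add: algebra_simps)
  finally show ?thesis .
qed

text \<open>The new gap vector is \<open>1 - t\<close> times the old one minus
  \<open>\<eta> - b\<close> times \<open>g\<close>, so scalar convexity applies in each
  coordinate.\<close>

lemma momentum_gap_step:
  assumes c: "x \<in> carrier_vec d" "y \<in> carrier_vec d" "g \<in> carrier_vec d" and t: "0 < t" "t \<le> 1"
  shows "(vnorm ((x - \<eta> \<cdot>\<^sub>v g) - (((1 - t) \<cdot>\<^sub>v y + t \<cdot>\<^sub>v x) - b \<cdot>\<^sub>v g)))\<^sup>2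
    \<le> (1 - t) * (vnorm (x - y))\<^sup>2 + (\<eta> - b)\<^sup>2 / t * (vnorm g)\<^sup>2"
proof -
  have "(vnorm ((x - \<eta> \<cdot>\<^sub>v g) - (((1 - t) \<cdot>\<^sub>v y + t \<cdot>\<^sub>v x) - b \<cdot>\<^sub>v g)))\<^sup>2
      = (\<Sum>i<d. ((1 - t) * (x $ i - y $ i) - (\<eta> - b) * g $ i)\<^sup>2)"
    unfolding vnorm_power2 using c by (intro sum.cong) (auto simp: algebra_simps)
  also have "\<dots> \<le> (\<Sum>i<d. (1 - t) * (x $ i - y $ i)\<^sup>2 + (\<eta> - b)\<^sup>2 / t * (g $ i)\<^sup>2)"
    by (intro sum_mono convex_combination_power2_le t)
  also have "\<dots> = (1 - t) * (vnorm (x - y))\<^sup>2 + (\<eta> - b)\<^sup>2 / t * (vnorm g)\<^sup>2"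
    using c by (simp add: vnorm_power2 sum.distrib sum_distrib_left)
  finally show ?thesis .
qed

lemma extrapolation_gap:
  assumes c: "x \<in> carrier_vec d" "y \<in> carrier_vec d"
  shows "(vnorm (((1 - t) \<cdot>\<^sub>v y + t \<cdot>\<^sub>v x) - x))\<^sup>2 = (1 - t)\<^sup>2 * (vnorm (x - y))\<^sup>2"
proof -
  have "(vnorm (((1 - t) \<cdot>\<^sub>v y + t \<cdot>\<^sub>v x) - x))\<^sup>2 = (\<Sum>i<d. ((1 - t) * (x $ i - y $ i))\<^sup>2)"
    unfolding vnorm_power2 using c
    by (intro sum.cong) (auto simp: algebra_simps power2_eq_square)
  also have "\<dots> = (1 - t)\<^sup>2 * (vnorm (x - y))\<^sup>2"
    using c by (simp add: vnorm_power2 power_mult_distrib sum_distrib_left)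
  finally show ?thesis .
qed

text \<open>The movement is \<open>- b\<close> times \<open>g\<close> plus \<open>t\<close> times
  the gap \<open>x - y\<close>, since \<open>y\<close> itself starts from the previous
  \<open>z\<close>.\<close>

lemma extrapolation_movement:
  assumes c: "x \<in> carrier_vec d" "z \<in> carrier_vec d" "g \<in> carrier_vec d" and y: "y = z - b \<cdot>\<^sub>v g"
  shows "(vnorm (((1 - t) \<cdot>\<^sub>v y + t \<cdot>\<^sub>v x) - z))\<^sup>2 \<le> 2 * b\<^sup>2 * (vnorm g)\<^sup>2 + 2 * t\<^sup>2 * (vnorm (x - y))\<^sup>2"
proof -
  have yc: "y \<in> carrier_vec d" using c y by simp
  have "(vnorm (((1 - t) \<cdot>\<^sub>v y + t \<cdot>\<^sub>v x) - z))\<^sup>2 = (\<Sum>i<d. ((- b) * g $ i + t * (x $ i - y $ i))\<^sup>2)"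
    unfolding vnorm_power2 using c yc by (intro sum.cong) (auto simp: y algebra_simps)
  also have "\<dots> \<le> (\<Sum>i<d. 2 * ((- b) * g $ i)\<^sup>2 + 2 * (t * (x $ i - y $ i))\<^sup>2)"
    by (intro sum_mono power2_sum_le)
  also have "\<dots> = 2 * b\<^sup>2 * (vnorm g)\<^sup>2 + 2 * t\<^sup>2 * (vnorm (x - y))\<^sup>2"
    using c yc by (simp add: vnorm_power2 sum.distrib sum_distrib_left power_mult_distrib mult.assoc)
  finally show ?thesis .
qed

subsection \<open>Sums along a run\<close>

text \<open>One number \<open>q\<close> is both epoch length and batch size, so variance and
  accumulation cancel. The bound on \<open>\<Lambda> k\<close> involves \<alpha> at index
  \<open>k\<close>, whereas extrapolation in iteration \<open>k\<close> uses index
  \<open>k + 1\<close>, that is \<open>2 / (k + 2)\<close>.\<close>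

locale spider_setting =
  fixes d n q m :: nat and f :: "nat \<Rightarrow> real vec \<Rightarrow> real" and L smin smax b \<delta> g0 :: real
    and \<Lambda> :: "nat \<Rightarrow> real" and K :: nat and x0 :: "real vec"
  assumes n: "n \<ge> 1" and q: "q \<ge> 1" and L: "L > 0" and smin: "smin > 0" and smax: "smax > 0"
    and x0: "x0 \<in> carrier_vec d"
    and f: "\<And>i. i \<in> {1..n} \<Longrightarrow> L_smooth d L (f i)"
    and b: "b = smin / ((3 + sqrt 15) * L * smax\<^sup>2)"
    and \<Lambda>: "\<And>k. k < K \<Longrightarrow> b \<le> \<Lambda> k \<and> \<Lambda> k \<le> (1 + 2 / (real k + 1)) * b"
begin

abbreviation "F \<equiv> objective n f"

abbreviation "run \<equiv> spider_sqn_m_run d n f q m \<delta> g0 (\<lambda>k. 2 / (real k + 1)) (\<lambda>_. b) \<Lambda> K x0"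

lemma b_pos: "b > 0"
proof -
  have "3 + sqrt 15 > 0" by (rule add_pos_nonneg) auto
  then show ?thesis using L smin smax by (simp add: b)
qed

lemma \<Lambda>_bounds:
  assumes "k < K"
  shows "0 \<le> \<Lambda> k - b" "\<Lambda> k - b \<le> 2 / (real k + 1) * b" "\<Lambda> k \<le> 3 * b"
proof -
  show "0 \<le> \<Lambda> k - b" using \<Lambda>[OF assms] by simp
  show *: "\<Lambda> k - b \<le> 2 / (real k + 1) * b" using \<Lambda>[OF assms] by (simp add: distrib_right)
  \<comment> \<open>The extreme case is \<open>k = 0\<close>, where \<alpha> equals 2.\<close>
  have "2 / (real k + 1) * b \<le> 2 * b"
    using b_pos by (intro mult_right_mono) (auto simp: divide_simps)
  then show "\<Lambda> k \<le> 3 * b" using * by simp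
qed

lemma F_smooth: "L_smooth d L F"
  using L_smooth_objective[OF n _ f] L by simp

lemma F_diff: "differentiable_Rd d F"
  using F_smooth by (simp add: L_smooth_def)

end

text \<open>One fixed realisation of the batches; the estimates here hold pathwise, before any
  expectation.\<close>

locale spider_path = spider_setting +
  fixes \<xi> x y z v H
  assumes run: "run \<xi> x y z v H"
    and H: "\<And>k. k < K \<Longrightarrow> loewner_le d (smin \<cdot>\<^sub>m 1\<^sub>m d) (H k) \<and> loewner_le d (H k) (smax \<cdot>\<^sub>m 1\<^sub>m d)"
begin

lemma x_init: "x 0 = x0" and y_init: "y 0 = x0"
  using run by (simp_all add: spider_sqn_m_run_def)

lemma z_eq: "k < K \<Longrightarrow> z k = (1 - 2 / (real k + 2)) \<cdot>\<^sub>v y k + (2 / (real k + 2)) \<cdot>\<^sub>v x k"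
  using run by (auto simp: spider_sqn_m_run_def add.commute add.left_commute)

lemma v_eq: "k < K \<Longrightarrow> v k = (if k mod q = 0 then grad d F (z k)
    else batch_grad d f (\<xi> k) (z k) - batch_grad d f (\<xi> k) (z (k - 1)) + v (k - 1))"
  and x_Suc: "k < K \<Longrightarrow> x (Suc k) = x k - \<Lambda> k \<cdot>\<^sub>v (H k *\<^sub>v v k)"
  and y_Suc: "k < K \<Longrightarrow> y (Suc k) = z k - b \<cdot>\<^sub>v (H k *\<^sub>v v k)"
  using run by (auto simp: spider_sqn_m_run_def)

lemma H_carrier: "k < K \<Longrightarrow> H k \<in> carrier_mat d d"
  using H[of k] loewner_bounds(1)[of d smin "H k" smax "0\<^sub>v d"] smin smax by simp

lemma carriers:
  "N \<le> K \<Longrightarrow> (\<forall>k\<le>N. x k \<in> carrier_vec d \<and> y k \<in> carrier_vec d) \<and>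
    (\<forall>k<N. z k \<in> carrier_vec d \<and> v k \<in> carrier_vec d)"
proof (induction N)
  case 0
  then show ?case using x_init y_init x0 by simp
next
  case (Suc N)
  then have N: "N < K" and xy: "x N \<in> carrier_vec d" "y N \<in> carrier_vec d" by auto
  have z: "z N \<in> carrier_vec d" using z_eq[OF N] xy by simp
  have v: "v N \<in> carrier_vec d"
  proof (cases "N mod q = 0")
    case True
    then show ?thesis using v_eq[OF N] grad_carrier[OF F_diff z] by simp
  next
    case False
    then have "N - 1 < N" by (cases N) auto
    then have "v (N - 1) \<in> carrier_vec d" using Suc by auto
    then show ?thesis using v_eq[OF N] False by (simp add: batch_grad_def)
  qed
  have "x (Suc N) \<in> carrier_vec d" "y (Suc N) \<in> carrier_vec d"
    using x_Suc[OF N] y_Suc[OF N] xy z v H_carrier[OF N] by auto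
  then show ?case using Suc z v by (auto simp: le_Suc_eq less_Suc_eq)
qed

lemma x_carrier: "k \<le> K \<Longrightarrow> x k \<in> carrier_vec d"
  and y_carrier: "k \<le> K \<Longrightarrow> y k \<in> carrier_vec d"
  and z_carrier: "k < K \<Longrightarrow> z k \<in> carrier_vec d"
  and v_carrier: "k < K \<Longrightarrow> v k \<in> carrier_vec d"
  using carriers[of K] by auto

lemma dir_carrier: "k < K \<Longrightarrow> H k *\<^sub>v v k \<in> carrier_vec d"
  by (rule mult_mat_vec_carrier[OF H_carrier v_carrier])

definition "sqdir k = (vnorm (H k *\<^sub>v v k))\<^sup>2"
definition "sqgap k = (if k \<le> K then (vnorm (x k - y k))\<^sup>2 else 0)"
definition "sqerr k = (vnorm (v k - grad d F (z k)))\<^sup>2"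
text \<open>At \<open>k = 0\<close> truncated subtraction compares \<open>z 0\<close> with itself,
  so sums of movements start at 1.\<close>

definition "sqmove k = (vnorm (z k - z (k - 1)))\<^sup>2"

lemma sqdir_nonneg: "0 \<le> sqdir k" and sqgap_nonneg: "0 \<le> sqgap k"
  by (simp_all add: sqdir_def sqgap_def)

lemma sqgap_0: "sqgap 0 = 0"
  using x0 by (simp add: sqgap_def x_init y_init vnorm_power2)

lemma sqgap_step:
  assumes k: "k < K"
  shows "sqgap (Suc k) \<le> (1 - 2 / (real k + 2)) * sqgap k + (\<Lambda> k - b)\<^sup>2 * (real k + 2) / 2 * sqdir k"
  using momentum_gap_step[of "x k" d "y k" "H k *\<^sub>v v k" "2 / (real k + 2)" "\<Lambda> k" b]
    x_carrier[of k] y_carrier[of k] dir_carrier[OF k] k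
  by (simp add: sqgap_def sqdir_def x_Suc y_Suc z_eq)

lemma gap_sums:
  "(\<Sum>k<K. (1 - 2 / (real k + 2))\<^sup>2 * sqgap k) \<le> (\<Sum>k<K. 3 * b\<^sup>2 * sqdir k)"
  "(\<Sum>k<K. (2 / (real k + 2))\<^sup>2 * sqgap k) \<le> (\<Sum>k<K. (\<Lambda> k - b)\<^sup>2 * sqdir k)"
  by (rule momentum_gap_sum[OF sqgap_0 sqgap_nonneg sqdir_nonneg _ sqgap_step],
      use \<Lambda>_bounds in blast, assumption)+

lemma sqmove_le:
  assumes k: "1 \<le> k" "k < K"
  shows "sqmove k \<le> 2 * b\<^sup>2 * sqdir (k - 1) + 2 * (2 / (real k + 2))\<^sup>2 * sqgap k"
proof -
  have "k - 1 < K" using k by simp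
  moreover have "Suc (k - 1) = k" using k by simp
  ultimately have "y k = z (k - 1) - b \<cdot>\<^sub>v (H (k - 1) *\<^sub>v v (k - 1))"
    using y_Suc[of "k - 1"] by simp
  from extrapolation_movement[OF x_carrier[of k] z_carrier[of "k - 1"] dir_carrier[of "k - 1"] this,
      of "2 / (real k + 2)"] k
  show ?thesis by (simp add: sqmove_def sqgap_def sqdir_def z_eq)
qed

lemma sqmove_sum:
  "(\<Sum>k\<in>{1..<K}. sqmove k) \<le> (\<Sum>k<K. (2 * b\<^sup>2 + 2 * (\<Lambda> k - b)\<^sup>2) * sqdir k)"
proof -
  have "(\<Sum>k\<in>{1..<K}. sqmove k)
      \<le> (\<Sum>k\<in>{1..<K}. 2 * b\<^sup>2 * sqdir (k - 1)) + (\<Sum>k\<in>{1..<K}. 2 * ((2 / (real k + 2))\<^sup>2 * sqgap k))"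
    using sqmove_le by (subst sum.distrib[symmetric], intro sum_mono) (auto simp: mult.assoc)
  also have "(\<Sum>k\<in>{1..<K}. 2 * b\<^sup>2 * sqdir (k - 1)) \<le> (\<Sum>k<K. 2 * b\<^sup>2 * sqdir k)"
  proof -
    have "(\<Sum>k\<in>{1..<K}. 2 * b\<^sup>2 * sqdir (k - 1)) = (\<Sum>k\<in>(\<lambda>k. k - 1) ` {1..<K}. 2 * b\<^sup>2 * sqdir k)"
      by (subst sum.reindex) (auto intro!: inj_onI)
    also have "\<dots> \<le> (\<Sum>k<K. 2 * b\<^sup>2 * sqdir k)"
      by (intro sum_mono2) (auto simp: sqdir_nonneg)
    finally show ?thesis .
  qed
  also have "(\<Sum>k\<in>{1..<K}. 2 * ((2 / (real k + 2))\<^sup>2 * sqgap k)) \<le> (\<Sum>k<K. 2 * ((2 / (real k + 2))\<^sup>2 * sqgap k))"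
    by (intro sum_mono2) (auto simp: sqgap_nonneg)
  also have "\<dots> \<le> 2 * (\<Sum>k<K. (\<Lambda> k - b)\<^sup>2 * sqdir k)"
    using gap_sums(2) by (simp add: sum_distrib_left[symmetric])
  finally show ?thesis
    by (simp add: sum.distrib sum_distrib_left algebra_simps)
qed

text \<open>Telescoping the one-step descent and bounding the gap sum turns the gap into
  \<open>3 / 2 * L * b\<^sup>2\<close> per squared direction. The errors stay, being controlled only
  in expectation.\<close>

lemma descent_sum:
  "F (x K) \<le> F x0 + (\<Sum>k<K. (- \<Lambda> k * (smin / smax\<^sup>2) + 3 / 2 * L * (\<Lambda> k)\<^sup>2 + 3 / 2 * L * b\<^sup>2) * sqdir k)
    + (\<Sum>k<K. sqerr k) / (2 * L)"
proof -
  let ?c = "\<lambda>k. - \<Lambda> k * (smin / smax\<^sup>2) + 3 / 2 * L * (\<Lambda> k)\<^sup>2"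
  let ?g = "\<lambda>k. (1 - 2 / (real k + 2))\<^sup>2 * sqgap k"
  have step: "F (x (Suc k)) \<le> F (x k) + ?c k * sqdir k + sqerr k / (2 * L) + L / 2 * ?g k"
    if k: "k < K" for k
  proof -
    have "smin / smax\<^sup>2 * (vnorm (H k *\<^sub>v v k))\<^sup>2 \<le> scalar_prod (v k) (H k *\<^sub>v v k)"
      using loewner_bounds(2)[of d smin "H k" smax "v k"] H[OF k] smin smax v_carrier[OF k] by simp
    then have "F (x k - \<Lambda> k \<cdot>\<^sub>v (H k *\<^sub>v v k)) \<le> F (x k) + ?c k * (vnorm (H k *\<^sub>v v k))\<^sup>2
      + (vnorm (v k - grad d F (z k)))\<^sup>2 / (2 * L) + L / 2 * (vnorm (z k - x k))\<^sup>2"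
      using \<Lambda>_bounds(1)[OF k] b_pos k
      by (intro step_descent[OF F_smooth L] x_carrier z_carrier v_carrier dir_carrier) auto
    moreover have "(vnorm (z k - x k))\<^sup>2 = ?g k"
      using extrapolation_gap[of "x k" d "y k" "2 / (real k + 2)"] k x_carrier[of k] y_carrier[of k]
      by (simp add: z_eq sqgap_def)
    ultimately show ?thesis by (simp add: x_Suc[OF k] sqdir_def sqerr_def)
  qed
  have "F (x N) \<le> F x0 + (\<Sum>k<N. ?c k * sqdir k) + (\<Sum>k<N. sqerr k / (2 * L)) + (\<Sum>k<N. L / 2 * ?g k)"
    if "N \<le> K" for N
    using that
  proof (induction N)
    case 0
    then show ?case by (simp add: x_init)
  next
    case (Suc N)
    then show ?case using step[of N] by simp
  qed
  from this[of K] have "F (x K) \<le> F x0 + (\<Sum>k<K. ?c k * sqdir k) + (\<Sum>k<K. sqerr k) / (2 * L)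
      + L / 2 * (\<Sum>k<K. ?g k)"
    by (simp add: sum_divide_distrib sum_distrib_left)
  also have "L / 2 * (\<Sum>k<K. ?g k) \<le> L / 2 * (\<Sum>k<K. 3 * b\<^sup>2 * sqdir k)"
    using gap_sums(1) L by (intro mult_left_mono) auto
  also have "L / 2 * (\<Sum>k<K. 3 * b\<^sup>2 * sqdir k) = (\<Sum>k<K. 3 / 2 * L * b\<^sup>2 * sqdir k)"
    by (simp add: sum_distrib_left algebra_simps)
  finally show ?thesis by (simp add: sum.distrib distrib_right)
qed

lemma sqgrad_le:
  assumes k: "k < K"
  shows "(vnorm (grad d F (z k)))\<^sup>2 \<le> 2 / smin\<^sup>2 * sqdir k + 2 * sqerr k"
proof -
  have G: "grad d F (z k) \<in> carrier_vec d" by (rule grad_carrier[OF F_diff z_carrier[OF k]])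
  have "smin * vnorm (v k) \<le> vnorm (H k *\<^sub>v v k)"
    using loewner_bounds(3)[of d smin "H k" smax "v k"] H[OF k] smin smax v_carrier[OF k] by simp
  then have "(smin * vnorm (v k))\<^sup>2 \<le> sqdir k"
    unfolding sqdir_def using smin by (intro power_mono) auto
  then have vle: "(vnorm (v k))\<^sup>2 \<le> sqdir k / smin\<^sup>2"
    using smin by (simp add: pos_le_divide_eq power_mult_distrib mult.commute)
  have "(vnorm (grad d F (z k)))\<^sup>2 = (\<Sum>i<d. (v k $ i + (- (v k $ i - grad d F (z k) $ i)))\<^sup>2)"
    using G by (simp add: vnorm_power2)
  also have "\<dots> \<le> (\<Sum>i<d. 2 * (v k $ i)\<^sup>2 + 2 * (- (v k $ i - grad d F (z k) $ i))\<^sup>2)"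
    by (intro sum_mono power2_sum_le)
  also have "\<dots> = (\<Sum>i<d. 2 * (v k $ i)\<^sup>2 + 2 * (v k $ i - grad d F (z k) $ i)\<^sup>2)"
    by (simp only: power2_minus)
  also have "\<dots> = 2 * (vnorm (v k))\<^sup>2 + 2 * sqerr k"
    using G v_carrier[OF k] by (simp add: sqerr_def vnorm_power2 sum.distrib sum_distrib_left)
  finally show ?thesis using vle by simp
qed

end

subsection \<open>Expected sums\<close>

text \<open>The sequences are functions of the whole batch family, constrained only on the support
  of its law. That support is finite, which settles all integrability questions.\<close>

locale spider_random = spider_setting +
  fixes x y z v H
  assumes run: "\<And>\<xi>. \<xi> \<in> set_pmf (batches n q q K) \<Longrightarrow> run \<xi> (x \<xi>) (y \<xi>) (z \<xi>) (v \<xi>) (H \<xi>)"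
    and H: "hessian_approx_bounded d smin smax K (batches n q q K) H"
begin

abbreviation "P \<equiv> batches n q q K"

abbreviation "expect \<equiv> measure_pmf.expectation P"

text \<open>Random counterparts of the pathwise quantities, with the index first so that
  \<open>Dir k\<close> is itself a random variable.\<close>

definition "Dir k \<xi> = (vnorm (H \<xi> k *\<^sub>v v \<xi> k))\<^sup>2"
definition "Err k \<xi> = (vnorm (v \<xi> k - grad d F (z \<xi> k)))\<^sup>2"
definition "Move k \<xi> = (vnorm (z \<xi> k - z \<xi> (k - 1)))\<^sup>2"

lemma path:
  assumes "\<xi> \<in> set_pmf P"
  shows "spider_path d n q m f L smin smax b \<delta> g0 \<Lambda> K x0 \<xi> (x \<xi>) (y \<xi>) (z \<xi>) (v \<xi>) (H \<xi>)"
  using run[OF assms] H assms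
  by (intro spider_path.intro spider_path_axioms.intro spider_setting_axioms)
    (auto simp: hessian_approx_bounded_def)

lemma finite_batch_law: "finite (set_pmf (replicate_pmf q (pmf_of_set {1..n})))"
  using n by (intro finite_set_replicate_pmf) (subst set_pmf_of_set, auto)

lemma finite_P: "finite (set_pmf P)"
  unfolding batches_def by (intro finite_set_Pi_pmf finite_batch_law) auto

lemma integrable_P [simp]: "integrable (measure_pmf P) h" for h :: "_ \<Rightarrow> real"
  by (rule integrable_measure_pmf_finite[OF finite_P])

lemma expect_mono: "(\<And>\<xi>. \<xi> \<in> set_pmf P \<Longrightarrow> g \<xi> \<le> h \<xi>) \<Longrightarrow> expect g \<le> expect h"
  for g h :: "_ \<Rightarrow> real"
  by (rule expectation_mono_finite[OF finite_P])

lemma expect_nonneg: "(\<And>\<xi>. 0 \<le> h \<xi>) \<Longrightarrow> 0 \<le> expect h" for h :: "_ \<Rightarrow> real"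
  by (rule Bochner_Integration.integral_nonneg)

text \<open>Redrawing only the batch \<open>k\<close> changes neither \<open>z\<^sub>k\<close>, \<open>z\<^bsub>k-1\<^esub>\<close> nor \<open>v\<^bsub>k-1\<^esub>\<close>, so integrating that
  coordinate of the product law alone plays the role of the conditional expectation.\<close>

lemma expect_Err_step:
  assumes k: "k < K" and kq: "k mod q \<noteq> 0"
  shows "expect (Err k) \<le> expect (Err (k - 1)) + L\<^sup>2 * expect (Move k) / real q"
proof -
  let ?A = "{k. k < K \<and> k mod q \<noteq> 0}" and ?U = "replicate_pmf q (pmf_of_set {1..n})"
  have k1: "k - 1 < k" using kq by (cases k) auto
  then have k1K: "k - 1 < K" using k by simp
  have "expect (Err k) \<le> expect (\<lambda>\<xi>. Err (k - 1) \<xi> + L\<^sup>2 * Move k \<xi> / real q)"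
    unfolding batches_def
  proof (rule expectation_Pi_pmf_le[of ?A k])
    fix \<xi> assume "\<xi> \<in> set_pmf (Pi_pmf ?A [] (\<lambda>_. ?U))"
    then have \<xi>: "\<xi> \<in> set_pmf P" by (simp add: batches_def)
    interpret p: spider_path d n q m f L smin smax b \<delta> g0 \<Lambda> K x0 \<xi> "x \<xi>" "y \<xi>" "z \<xi>" "v \<xi>" "H \<xi>"
      by (rule path[OF \<xi>])
    let ?z = "z \<xi> k" and ?z' = "z \<xi> (k - 1)" and ?v' = "v \<xi> (k - 1)"
    define \<Delta> where "\<Delta> i j = grad d (f i) ?z $ j - grad d (f i) ?z' $ j" for i j
    define e where "e j = ?v' $ j - grad d F ?z' $ j" for j
    have zc: "?z \<in> carrier_vec d" "?z' \<in> carrier_vec d" and vc: "?v' \<in> carrier_vec d"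
      using p.z_carrier p.v_carrier k k1K by auto
    have diff: "differentiable_Rd d (f i)" if "i \<in> {1..n}" for i
      using f[OF that] by (simp add: L_smooth_def)
    have G: "grad d F u = vec d (\<lambda>j. (\<Sum>i=1..n. grad d (f i) u $ j) / real n)"
      if "u \<in> carrier_vec d" for u
      by (rule grad_objective[OF n _ that]) (rule diff)
    have frozen: "z (\<xi>(k := a)) k = ?z" "z (\<xi>(k := a)) (k - 1) = ?z'" "v (\<xi>(k := a)) (k - 1) = ?v'"
      "v (\<xi>(k := a)) k = batch_grad d f a ?z - batch_grad d f a ?z' + ?v'"
      if a: "a \<in> set_pmf ?U" for a
    proof -
      \<comment> \<open>Runs are specified only on the support, so the redrawn family must be shown
        to lie in it.\<close>
      have mem: "\<xi>(k := a) \<in> set_pmf P"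
        using \<xi> a k kq unfolding batches_def by (auto simp: set_Pi_pmf PiE_dflt_def)
      interpret p': spider_path d n q m f L smin smax b \<delta> g0 \<Lambda> K x0 "\<xi>(k := a)" "x (\<xi>(k := a))"
        "y (\<xi>(k := a))" "z (\<xi>(k := a))" "v (\<xi>(k := a))" "H (\<xi>(k := a))"
        by (rule path[OF mem])
      \<comment> \<open>Agreement of the batches below \<open>k\<close> covers \<open>z\<close> only
        below \<open>k\<close>; \<open>z\<close> at \<open>k\<close> follows from \<open>x\<close>
        and \<open>y\<close> at \<open>k\<close>.\<close>
      have "(\<forall>i\<le>k. x (\<xi>(k := a)) i = x \<xi> i \<and> y (\<xi>(k := a)) i = y \<xi> i) \<and>
          (\<forall>i<k. z (\<xi>(k := a)) i = z \<xi> i \<and> v (\<xi>(k := a)) i = v \<xi> i)"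
        using k by (intro spider_run_prefix[OF p'.run p.run]) auto
      then show z: "z (\<xi>(k := a)) k = ?z" and z': "z (\<xi>(k := a)) (k - 1) = ?z'"
        and v': "v (\<xi>(k := a)) (k - 1) = ?v'"
        using k1 by (auto simp: p.z_eq[OF k] p'.z_eq[OF k])
      show "v (\<xi>(k := a)) k = batch_grad d f a ?z - batch_grad d f a ?z' + ?v'"
        using p'.v_eq[OF k] kq unfolding z z' v' by simp
    qed
    have err: "Err k (\<xi>(k := a)) = (\<Sum>j<d. (e j + ((\<Sum>i\<leftarrow>a. \<Delta> i j) / real (length a)
        - (\<Sum>i=1..n. \<Delta> i j) / real n))\<^sup>2)" if a: "a \<in> set_pmf ?U" for a
    proof -
      \<comment> \<open>The new error is the old error plus the centred sampling error of the
        gradient change.\<close>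
      have "(v (\<xi>(k := a)) k - grad d F (z (\<xi>(k := a)) k)) $ j
          = e j + ((\<Sum>i\<leftarrow>a. \<Delta> i j) / real (length a) - (\<Sum>i=1..n. \<Delta> i j) / real n)"
        if "j < d" for j
        using that vc unfolding frozen(1,4)[OF a] G[OF zc(1)] e_def G[OF zc(2)]
        by (simp add: batch_grad_def \<Delta>_def sum_list_subtractf sum_subtractf diff_divide_distrib)
      moreover have "dim_vec (v (\<xi>(k := a)) k - grad d F (z (\<xi>(k := a)) k)) = d"
        unfolding frozen(1,4)[OF a] G[OF zc(1)] by simp
      ultimately show ?thesis unfolding Err_def vnorm_power2 by (intro sum.cong) auto
    qed
    have "measure_pmf.expectation ?U (\<lambda>a. Err k (\<xi>(k := a)))
        \<le> (\<Sum>j<d. (e j)\<^sup>2) + (\<Sum>i=1..n. \<Sum>j<d. (\<Delta> i j)\<^sup>2) / real n / real q"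
      using minibatch_variance_le[OF n q, where d=d and e=e and \<Delta>=\<Delta>] expectation_cong_set_pmf[of ?U, OF err] by simp
    also have "(\<Sum>j<d. (e j)\<^sup>2) = Err (k - 1) \<xi>"
      using grad_carrier[OF F_diff zc(2)] by (simp add: Err_def vnorm_power2 e_def)
    also have "Err (k - 1) \<xi> + (\<Sum>i=1..n. \<Sum>j<d. (\<Delta> i j)\<^sup>2) / real n / real q
        \<le> Err (k - 1) \<xi> + (\<Sum>i=1..n. L\<^sup>2 * Move k \<xi>) / real n / real q"
    proof (intro add_left_mono divide_right_mono sum_mono)
      fix i assume i: "i \<in> {1..n}"
      have "(\<Sum>j<d. (\<Delta> i j)\<^sup>2) = (vnorm (grad d (f i) ?z - grad d (f i) ?z'))\<^sup>2"
        using grad_carrier[OF diff[OF i] zc(2)] by (simp add: vnorm_power2 \<Delta>_def)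
      also have "\<dots> \<le> (L * vnorm (?z - ?z'))\<^sup>2"
        using f[OF i] zc by (intro power_mono) (auto simp: L_smooth_def)
      finally show "(\<Sum>j<d. (\<Delta> i j)\<^sup>2) \<le> L\<^sup>2 * Move k \<xi>" by (simp add: Move_def power_mult_distrib)
    qed auto
    also have "\<dots> = Err (k - 1) \<xi> + L\<^sup>2 * Move k \<xi> / real q" using n by simp
    \<comment> \<open>The bound is constant in the redrawn batch, so it equals its own average, the
      form required for comparing integrals over one coordinate.\<close>
    also have "\<dots> = measure_pmf.expectation ?U (\<lambda>a. Err (k - 1) \<xi> + L\<^sup>2 * Move k \<xi> / real q)"
      by simp
    also have "\<dots> = measure_pmf.expectation ?U
        (\<lambda>a. Err (k - 1) (\<xi>(k := a)) + L\<^sup>2 * Move k (\<xi>(k := a)) / real q)"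
      by (rule expectation_cong_set_pmf) (simp only: Err_def Move_def frozen)
    finally show "measure_pmf.expectation ?U (\<lambda>a. Err k (\<xi>(k := a)))
        \<le> measure_pmf.expectation ?U
          (\<lambda>a. Err (k - 1) (\<xi>(k := a)) + L\<^sup>2 * Move k (\<xi>(k := a)) / real q)" .
  qed (use k kq finite_batch_law in auto)
  then show ?thesis by simp
qed

lemma expect_Err_sum: "(\<Sum>k<K. expect (Err k)) \<le> L\<^sup>2 * (\<Sum>k\<in>{1..<K}. expect (Move k))"
proof -
  have "(\<Sum>k<K. expect (Err k)) \<le> (\<Sum>k\<in>{1..<K}. L\<^sup>2 * expect (Move k))"
  proof (rule epoch_error_sum[OF q])
    show "expect (Err k) = 0" if k: "k < K" and kq: "k mod q = 0" for k
    proof -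
      have "Err k \<xi> = 0" if "\<xi> \<in> set_pmf P" for \<xi>
      proof -
        interpret p: spider_path d n q m f L smin smax b \<delta> g0 \<Lambda> K x0 \<xi> "x \<xi>" "y \<xi>" "z \<xi>" "v \<xi>" "H \<xi>"
          by (rule path[OF that])
        show ?thesis
          using p.v_eq[OF k] kq grad_carrier[OF F_diff p.z_carrier[OF k]]
          by (simp add: Err_def vnorm_power2)
      qed
      then have "expect (Err k) = expect (\<lambda>_. 0)" by (rule expectation_cong_set_pmf)
      then show ?thesis by simp
    qed
    show "expect (Err k) \<le> expect (Err (k - 1)) + L\<^sup>2 * expect (Move k) / real q"
      if "k < K" "k mod q \<noteq> 0" for k
      by (rule expect_Err_step[OF that])
  qed (auto simp: Err_def Move_def intro!: expect_nonneg mult_nonneg_nonneg)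
  then show ?thesis by (simp add: sum_distrib_left)
qed

text \<open>In expectation, errors are traded for movements and movements for directions. Each
  direction then has a coefficient at most \<open>- smin / smax\<^sup>2 * b / 20\<close>, while the
  objective cannot fall below \<open>fmin\<close>.\<close>

lemma expect_Dir_sum:
  assumes lower: "\<And>u. u \<in> carrier_vec d \<Longrightarrow> fmin \<le> F u"
  shows "smin / smax\<^sup>2 * b / 20 * (\<Sum>k<K. expect (Dir k)) \<le> F x0 - fmin"
proof -
  let ?a = "smin / smax\<^sup>2"
  let ?c = "\<lambda>k. - \<Lambda> k * ?a + 3 / 2 * L * (\<Lambda> k)\<^sup>2 + 3 / 2 * L * b\<^sup>2"
  let ?m = "\<lambda>k. 2 * b\<^sup>2 + 2 * (\<Lambda> k - b)\<^sup>2"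
  \<comment> \<open>The prescribed step size in the form needed for the coefficient estimate, with
    \<open>a = smin / smax\<^sup>2\<close>.\<close>
  have bb: "b = ?a / ((3 + sqrt 15) * L)" by (simp add: b field_simps)
  have "fmin \<le> expect (\<lambda>\<xi>. F x0 + (\<Sum>k<K. ?c k * Dir k \<xi>) + (\<Sum>k<K. Err k \<xi>) / (2 * L))"
  proof -
    have "expect (\<lambda>_. fmin)
        \<le> expect (\<lambda>\<xi>. F x0 + (\<Sum>k<K. ?c k * Dir k \<xi>) + (\<Sum>k<K. Err k \<xi>) / (2 * L))"
    proof (rule expect_mono)
      fix \<xi> assume \<xi>: "\<xi> \<in> set_pmf P"
      interpret p: spider_path d n q m f L smin smax b \<delta> g0 \<Lambda> K x0 \<xi> "x \<xi>" "y \<xi>" "z \<xi>" "v \<xi>" "H \<xi>"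
        by (rule path[OF \<xi>])
      show "fmin \<le> F x0 + (\<Sum>k<K. ?c k * Dir k \<xi>) + (\<Sum>k<K. Err k \<xi>) / (2 * L)"
        using p.descent_sum lower[OF p.x_carrier[OF order_refl]]
        by (simp add: p.sqdir_def p.sqerr_def Dir_def Err_def)
    qed
    then show ?thesis by simp
  qed
  also have "\<dots> = F x0 + (\<Sum>k<K. ?c k * expect (Dir k)) + (\<Sum>k<K. expect (Err k)) / (2 * L)"
    by simp
  also have "\<dots> \<le> F x0 + (\<Sum>k<K. ?c k * expect (Dir k)) + L\<^sup>2 * (\<Sum>k<K. ?m k * expect (Dir k)) / (2 * L)"
  proof (intro add_left_mono divide_right_mono)
    have "(\<Sum>k\<in>{1..<K}. expect (Move k)) = expect (\<lambda>\<xi>. \<Sum>k\<in>{1..<K}. Move k \<xi>)" by simp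
    also have "\<dots> \<le> expect (\<lambda>\<xi>. \<Sum>k<K. ?m k * Dir k \<xi>)"
    proof (rule expect_mono)
      fix \<xi> assume \<xi>: "\<xi> \<in> set_pmf P"
      interpret p: spider_path d n q m f L smin smax b \<delta> g0 \<Lambda> K x0 \<xi> "x \<xi>" "y \<xi>" "z \<xi>" "v \<xi>" "H \<xi>"
        by (rule path[OF \<xi>])
      show "(\<Sum>k\<in>{1..<K}. Move k \<xi>) \<le> (\<Sum>k<K. ?m k * Dir k \<xi>)"
        using p.sqmove_sum by (simp add: p.sqmove_def p.sqdir_def Move_def Dir_def)
    qed
    finally have "(\<Sum>k\<in>{1..<K}. expect (Move k)) \<le> (\<Sum>k<K. ?m k * expect (Dir k))" by simp
    from mult_left_mono[OF this, of "L\<^sup>2"] expect_Err_sum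
    show "(\<Sum>k<K. expect (Err k)) \<le> L\<^sup>2 * (\<Sum>k<K. ?m k * expect (Dir k))" by simp
  qed (use L in simp)
  also have "\<dots> = F x0 + (\<Sum>k<K. (- \<Lambda> k * ?a + 3 / 2 * L * (\<Lambda> k)\<^sup>2 + L * (b\<^sup>2 + (\<Lambda> k - b)\<^sup>2)
      + 3 / 2 * L * b\<^sup>2) * expect (Dir k))"
  proof -
    have "L\<^sup>2 * (\<Sum>k<K. ?m k * expect (Dir k)) / (2 * L) = L / 2 * (\<Sum>k<K. ?m k * expect (Dir k))"
      using L by (simp add: power2_eq_square)
    also have "\<dots> = (\<Sum>k<K. L * (b\<^sup>2 + (\<Lambda> k - b)\<^sup>2) * expect (Dir k))"
      by (simp add: sum_distrib_left algebra_simps)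
    finally show ?thesis
      by (simp add: add.assoc sum.distrib[symmetric] distrib_right[symmetric] add.commute add.left_commute)
  qed
  also have "\<dots> \<le> F x0 + (\<Sum>k<K. (- ?a * b / 20) * expect (Dir k))"
  proof (intro add_left_mono sum_mono mult_right_mono)
    fix k assume "k \<in> {..<K}"
    then show "- \<Lambda> k * ?a + 3 / 2 * L * (\<Lambda> k)\<^sup>2 + L * (b\<^sup>2 + (\<Lambda> k - b)\<^sup>2) + 3 / 2 * L * b\<^sup>2 \<le> - ?a * b / 20"
      using \<Lambda>_bounds[of k] smin smax by (intro step_coefficient_le[OF _ L bb]) auto
  qed (simp add: expect_nonneg Dir_def)
  also have "\<dots> = F x0 - ?a * b / 20 * (\<Sum>k<K. expect (Dir k))"
    by (simp only: sum_distrib_left[symmetric])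
  finally show ?thesis by simp
qed

text \<open>Here the cruder bound \<open>(\<Lambda> k - b)\<^sup>2 \<le> (2 * b)\<^sup>2\<close>
  suffices: movements cost \<open>10 * b\<^sup>2\<close> per direction, and the errors enter
  doubled.\<close>

lemma expect_sqgrad_sum:
  "(\<Sum>k<K. expect (\<lambda>\<xi>. (vnorm (grad d F (z \<xi> k)))\<^sup>2))
    \<le> (2 / smin\<^sup>2 + 20 * L\<^sup>2 * b\<^sup>2) * (\<Sum>k<K. expect (Dir k))"
proof -
  have "(\<Sum>k<K. expect (\<lambda>\<xi>. (vnorm (grad d F (z \<xi> k)))\<^sup>2))
      \<le> (\<Sum>k<K. expect (\<lambda>\<xi>. 2 / smin\<^sup>2 * Dir k \<xi> + 2 * Err k \<xi>))"
  proof (intro sum_mono expect_mono)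
    fix k \<xi> assume k: "k \<in> {..<K}" and \<xi>: "\<xi> \<in> set_pmf P"
    interpret p: spider_path d n q m f L smin smax b \<delta> g0 \<Lambda> K x0 \<xi> "x \<xi>" "y \<xi>" "z \<xi>" "v \<xi>" "H \<xi>"
      by (rule path[OF \<xi>])
    show "(vnorm (grad d F (z \<xi> k)))\<^sup>2 \<le> 2 / smin\<^sup>2 * Dir k \<xi> + 2 * Err k \<xi>"
      using p.sqgrad_le[of k] k by (simp add: p.sqdir_def p.sqerr_def Dir_def Err_def)
  qed
  also have "\<dots> = 2 / smin\<^sup>2 * (\<Sum>k<K. expect (Dir k)) + 2 * (\<Sum>k<K. expect (Err k))"
    by (simp add: sum.distrib sum_distrib_left)
  also have "(\<Sum>k<K. expect (Err k)) \<le> L\<^sup>2 * (\<Sum>k<K. 10 * b\<^sup>2 * expect (Dir k))"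
  proof -
    have "(\<Sum>k\<in>{1..<K}. expect (Move k)) = expect (\<lambda>\<xi>. \<Sum>k\<in>{1..<K}. Move k \<xi>)" by simp
    also have "\<dots> \<le> expect (\<lambda>\<xi>. \<Sum>k<K. 10 * b\<^sup>2 * Dir k \<xi>)"
    proof (rule expect_mono)
      fix \<xi> assume \<xi>: "\<xi> \<in> set_pmf P"
      interpret p: spider_path d n q m f L smin smax b \<delta> g0 \<Lambda> K x0 \<xi> "x \<xi>" "y \<xi>" "z \<xi>" "v \<xi>" "H \<xi>"
        by (rule path[OF \<xi>])
      have "(\<Sum>k\<in>{1..<K}. Move k \<xi>) \<le> (\<Sum>k<K. (2 * b\<^sup>2 + 2 * (\<Lambda> k - b)\<^sup>2) * Dir k \<xi>)"
        using p.sqmove_sum by (simp add: p.sqmove_def p.sqdir_def Move_def Dir_def)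
      also have "\<dots> \<le> (\<Sum>k<K. 10 * b\<^sup>2 * Dir k \<xi>)"
      proof (intro sum_mono mult_right_mono)
        fix k assume "k \<in> {..<K}"
        then have "(\<Lambda> k - b)\<^sup>2 \<le> (2 * b)\<^sup>2" using \<Lambda>_bounds[of k] by (intro power_mono) auto
        then show "2 * b\<^sup>2 + 2 * (\<Lambda> k - b)\<^sup>2 \<le> 10 * b\<^sup>2" by (simp add: power_mult_distrib)
      qed (simp add: Dir_def)
      finally show "(\<Sum>k\<in>{1..<K}. Move k \<xi>) \<le> (\<Sum>k<K. 10 * b\<^sup>2 * Dir k \<xi>)" .
    qed
    finally have "(\<Sum>k\<in>{1..<K}. expect (Move k)) \<le> (\<Sum>k<K. 10 * b\<^sup>2 * expect (Dir k))" by simp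
    from mult_left_mono[OF this, of "L\<^sup>2"] expect_Err_sum show ?thesis by simp
  qed
  finally show ?thesis by (simp add: sum_distrib_left algebra_simps)
qed

lemma expect_grad_output_le:
  assumes lower: "\<And>u. u \<in> carrier_vec d \<Longrightarrow> fmin \<le> F u" and \<epsilon>: "\<epsilon> > 0" and K: "K \<ge> 1"
    and large: "20 * (2 / smin\<^sup>2 + 20 * L\<^sup>2 * b\<^sup>2) / (smin / smax\<^sup>2 * b) * ((F x0 - fmin) / \<epsilon>\<^sup>2) \<le> real K"
  shows "measure_pmf.expectation (pair_pmf P (pmf_of_set {..<K}))
    (\<lambda>(\<xi>, \<zeta>). vnorm (grad d F (z \<xi> \<zeta>))) \<le> \<epsilon>"
proof -
  let ?a = "smin / smax\<^sup>2" and ?M = "2 / smin\<^sup>2 + 20 * L\<^sup>2 * b\<^sup>2"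
  let ?g = "\<lambda>\<xi> k. vnorm (grad d F (z \<xi> k))"
  have ne: "{..<K} \<noteq> {}" using K by (auto simp: lessThan_empty_iff)
  have ab: "?a * b > 0" using smin smax b_pos by simp
  have M: "?M > 0" using smin by (intro add_pos_nonneg) auto
  have "(\<Sum>k<K. expect (\<lambda>\<xi>. (?g \<xi> k)\<^sup>2)) \<le> ?M * (\<Sum>k<K. expect (Dir k))"
    by (rule expect_sqgrad_sum)
  also have "\<dots> \<le> ?M * (20 * (F x0 - fmin) / (?a * b))"
  proof (rule mult_left_mono)
    have rescale: "t / 20 * S \<le> X \<Longrightarrow> t * S \<le> 20 * X" for t S X :: real by simp
    have "(?a * b) * (\<Sum>k<K. expect (Dir k)) \<le> 20 * (F x0 - fmin)"
      by (rule rescale, rule expect_Dir_sum) (rule lower)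
    then show "(\<Sum>k<K. expect (Dir k)) \<le> 20 * (F x0 - fmin) / (?a * b)"
      unfolding pos_le_divide_eq[OF ab] by (simp only: mult.commute)
  qed (use M in simp)
  also have "\<dots> = (20 * ?M / (?a * b) * ((F x0 - fmin) / \<epsilon>\<^sup>2)) * \<epsilon>\<^sup>2"
  proof -
    have "M * (20 * X / c) = 20 * M / c * (X / \<epsilon>\<^sup>2) * \<epsilon>\<^sup>2" for M X c :: real using \<epsilon> by simp
    then show ?thesis .
  qed
  also have "\<dots> \<le> real K * \<epsilon>\<^sup>2" using large by (intro mult_right_mono) auto
  finally have sq: "(\<Sum>k<K. expect (\<lambda>\<xi>. (?g \<xi> k)\<^sup>2)) \<le> real K * \<epsilon>\<^sup>2" .
  have "measure_pmf.expectation (pair_pmf P (pmf_of_set {..<K})) (\<lambda>(\<xi>, \<zeta>). ?g \<xi> \<zeta>)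
      = expect (\<lambda>\<xi>. (\<Sum>k<K. ?g \<xi> k) / real K)"
    using finite_P ne by (simp add: pair_pmf_def expectation_bind_finite integral_pmf_of_set)
  \<comment> \<open>The pointwise inequality
    \<open>g \<le> g\<^sup>2 / (2 * \<epsilon>) + \<epsilon> / 2\<close> passes from second to first
    moments; its two parts average to at most \<open>\<epsilon> / 2\<close> each.\<close>
  also have "\<dots> \<le> expect (\<lambda>\<xi>. (\<Sum>k<K. (?g \<xi> k)\<^sup>2 / (2 * \<epsilon>) + \<epsilon> / 2) / real K)"
  proof (intro expect_mono divide_right_mono sum_mono)
    show "?g \<xi> k \<le> (?g \<xi> k)\<^sup>2 / (2 * \<epsilon>) + \<epsilon> / 2" for \<xi> k
    proof -
      have "(?g \<xi> k)\<^sup>2 / (2 * \<epsilon>) + \<epsilon> / 2 - ?g \<xi> k = (?g \<xi> k - \<epsilon>)\<^sup>2 / (2 * \<epsilon>)"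
        using \<epsilon> by (simp add: field_simps power2_eq_square)
      moreover have "0 \<le> (?g \<xi> k - \<epsilon>)\<^sup>2 / (2 * \<epsilon>)" using \<epsilon> by simp
      ultimately show ?thesis by linarith
    qed
  qed simp
  also have "\<dots> = ((\<Sum>k<K. expect (\<lambda>\<xi>. (?g \<xi> k)\<^sup>2)) / (2 * \<epsilon>) + real K * (\<epsilon> / 2)) / real K"
    by (simp add: sum.distrib sum_divide_distrib)
  also have "\<dots> \<le> (real K * \<epsilon>\<^sup>2 / (2 * \<epsilon>) + real K * (\<epsilon> / 2)) / real K"
    using sq \<epsilon> by (intro divide_right_mono add_right_mono) auto
  also have "\<dots> = \<epsilon>" using K \<epsilon> by (simp add: field_simps power2_eq_square)
  finally show ?thesis .
qed

end

subsection \<open>Oracle calls\<close>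

lemma card_multiples_le:
  assumes "q \<ge> 1"
  shows "real (card {k \<in> {..<K}. k mod q = 0}) \<le> real K / real q + 1"
proof -
  have "{k \<in> {..<K}. k mod q = 0} \<subseteq> (\<lambda>j. q * j) ` {..K div q}"
  proof
    fix k assume "k \<in> {k \<in> {..<K}. k mod q = 0}"
    then have "k = q * (k div q)" "k div q \<le> K div q" by (auto intro: div_le_mono)
    then show "k \<in> (\<lambda>j. q * j) ` {..K div q}" by blast
  qed
  then have "card {k \<in> {..<K}. k mod q = 0} \<le> card ((\<lambda>j. q * j) ` {..K div q})"
    by (rule card_mono[rotated]) simp
  also have "\<dots> \<le> K div q + 1" using card_image_le[of "{..K div q}" "\<lambda>j. q * j"] by simp
  finally have "real (card {k \<in> {..<K}. k mod q = 0}) \<le> real (K div q) + 1" by linarith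
  also have "real (K div q) \<le> real K / real q" 
    using assms by (simp add: pos_le_divide_eq flip: of_nat_mult)
  finally show ?thesis by simp
qed

text \<open>As \<open>sqrt n \<ge> 1\<close>, rounding in either direction changes it by at most a
  factor 2.\<close>

lemma rounded_sqrt_bounds:
  assumes n: "n \<ge> 1" and q: "q \<in> {nat \<lfloor>sqrt (real n)\<rfloor>, nat \<lceil>sqrt (real n)\<rceil>}"
  shows "q \<ge> 1" "sqrt (real n) \<le> 2 * real q" "real q \<le> 2 * sqrt (real n)"
proof -
  define s where "s = sqrt (real n)"
  have s: "1 \<le> s" using n by (simp add: s_def)
  have fl: "1 \<le> \<lfloor>s\<rfloor>" "1 \<le> \<lceil>s\<rceil>" using s by linarith+
  have "1 \<le> real q \<and> s \<le> 2 * real q \<and> real q \<le> 2 * s"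
    using q fl s unfolding s_def[symmetric] by (elim insertE emptyE; simp; linarith)
  then show "q \<ge> 1" "sqrt (real n) \<le> 2 * real q" "real q \<le> 2 * sqrt (real n)"
    by (auto simp: s_def)
qed

text \<open>Refreshes cost at most \<open>2 * sqrt n\<close> per iteration on average plus one extra
  \<open>n\<close>, batches at most \<open>4 * sqrt n\<close>. Rounding \<open>X\<close> up to
  \<open>K\<close> adds another \<open>6 * sqrt n \<le> 6 * n\<close>. The bound holds for every
  realisation.\<close>

lemma sfo_calls_le:
  assumes n: "n \<ge> 1" and q: "q \<in> {nat \<lfloor>sqrt (real n)\<rfloor>, nat \<lceil>sqrt (real n)\<rceil>}"
    and X: "X \<ge> 0" and K: "K = max 1 (nat \<lceil>X\<rceil>)" and \<xi>: "\<xi> \<in> set_pmf (batches n q q K)"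
  shows "real (sfo_calls n q K \<xi>) \<le> 7 * real n + 6 * X * sqrt (real n)"
proof -
  define s where "s = sqrt (real n)"
  note qb = rounded_sqrt_bounds[OF n q, folded s_def]
  have s: "1 \<le> s" "real n = s * s" using n by (simp_all add: s_def)
  have len: "length (\<xi> k) = q" if "k < K" "k mod q \<noteq> 0" for k
    using \<xi> that unfolding batches_def by (auto simp: set_Pi_pmf PiE_dflt_def set_replicate_pmf)
  \<comment> \<open>Refresh iterations are charged the batch cost as well, which keeps the second
    summand uniform.\<close>
  have "sfo_calls n q K \<xi> \<le> (\<Sum>k<K. (if k mod q = 0 then n else 0) + 2 * q)"
    unfolding sfo_calls_def by (intro sum_mono) (auto simp: len)
  also have "\<dots> = card {k \<in> {..<K}. k mod q = 0} * n + K * (2 * q)"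
    by (simp add: sum.distrib sum.If_cases Int_def)
  finally have "real (sfo_calls n q K \<xi>)
      \<le> real (card {k \<in> {..<K}. k mod q = 0}) * real n + real K * (2 * real q)"
    by (metis of_nat_add of_nat_le_iff of_nat_mult of_nat_numeral)
  also have "\<dots> \<le> (real K / real q + 1) * real n + real K * (2 * real q)"
    by (intro add_right_mono mult_right_mono card_multiples_le qb) auto
  also have "\<dots> = real K * (real n / real q) + real n + real K * (2 * real q)"
    by (simp add: distrib_right)
  also have "\<dots> \<le> real K * (2 * s) + real n + real K * (2 * (2 * s))"
  proof (intro add_mono mult_left_mono order_refl)
    have "s * s \<le> s * (2 * real q)" using qb s by (intro mult_left_mono) auto
    then show "real n / real q \<le> 2 * s" using qb(1) s by (simp add: divide_le_eq mult.commute mult.left_commute)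
  qed (use qb in auto)
  also have "\<dots> = real K * (6 * s) + real n" by simp
  also have "\<dots> \<le> (X + 1) * (6 * s) + real n"
  proof (intro add_right_mono mult_right_mono)
    show "real K \<le> X + 1" unfolding K using X by linarith
  qed (use s in auto)
  also have "\<dots> \<le> 7 * real n + 6 * X * s"
    using mult_left_mono[OF s(1), of s] s by (simp add: algebra_simps)
  finally show ?thesis by (simp add: s_def)
qed

theorem theorem2:
  fixes L smin smax :: real
  assumes "L > 0" "smin > 0" "smax > 0"
  shows "\<exists>C>0. \<forall>D::real. D \<ge> 0 \<longrightarrow> (\<exists>C'>0.
    \<forall>(d::nat) (n::nat) (f :: nat \<Rightarrow> real vec \<Rightarrow> real) (\<kappa>::real) (q::nat) (m::nat) (\<delta>::real) (g0::real)
     (\<alpha> :: nat \<Rightarrow> real) (\<beta> :: nat \<Rightarrow> real) (\<Lambda> :: nat \<Rightarrow> real) (x0 :: real vec) (\<epsilon>::real) (K::nat)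
     (x :: (nat \<Rightarrow> nat list) \<Rightarrow> nat \<Rightarrow> real vec) (y :: (nat \<Rightarrow> nat list) \<Rightarrow> nat \<Rightarrow> real vec)
     (z :: (nat \<Rightarrow> nat list) \<Rightarrow> nat \<Rightarrow> real vec) (v :: (nat \<Rightarrow> nat list) \<Rightarrow> nat \<Rightarrow> real vec)
     (H :: (nat \<Rightarrow> nat list) \<Rightarrow> nat \<Rightarrow> real mat).
      d \<ge> 1 \<and> n \<ge> 1 \<and> m \<ge> 1 \<and> \<delta> > 0 \<and> g0 > 0 \<and> \<kappa> > 0 \<and> \<epsilon> > 0 \<and> K \<ge> 1 \<and>
      x0 \<in> carrier_vec d \<and>
      bdd_below (objective n f ` carrier_vec d) \<and>
      D = objective n f x0 - (INF u \<in> carrier_vec d. objective n f u) \<and>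
      (\<forall>i \<in> {1..n}. L_smooth d L (f i)) \<and>
      (\<forall>i \<in> {1..n}. twice_continuously_differentiable d (f i) \<and>
         (\<forall>u \<in> carrier_vec d. spectral_norm (hess d (f i) u) \<le> \<kappa>)) \<and>
      q \<in> {nat \<lfloor>sqrt (real n)\<rfloor>, nat \<lceil>sqrt (real n)\<rceil>} \<and>
      (\<forall>k. \<alpha> k = 2 / (real k + 1)) \<and>
      (\<forall>k. \<beta> k = smin / ((3 + sqrt 15) * L * smax\<^sup>2)) \<and>
      (\<forall>k<K. \<beta> k \<le> \<Lambda> k \<and> \<Lambda> k \<le> (1 + \<alpha> k) * \<beta> k) \<and>
      (\<forall>\<xi> \<in> set_pmf (batches n q q K).
         spider_sqn_m_run d n f q m \<delta> g0 \<alpha> \<beta> \<Lambda> K x0 \<xi> (x \<xi>) (y \<xi>) (z \<xi>) (v \<xi>) (H \<xi>)) \<and>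
      hessian_approx_bounded d smin smax K (batches n q q K) H \<and>
      hessian_approx_dependence d K (batches n q q K) v H
      \<longrightarrow>
      (real K \<ge> C * (D / \<epsilon>\<^sup>2) \<longrightarrow>
         measure_pmf.expectation (pair_pmf (batches n q q K) (pmf_of_set {..<K}))
           (\<lambda>(\<xi>, \<zeta>). vnorm (grad d (objective n f) (z \<xi> \<zeta>))) \<le> \<epsilon>) \<and>
      (K = max 1 (nat \<lceil>C * (D / \<epsilon>\<^sup>2)\<rceil>) \<longrightarrow>
         (\<forall>\<xi> \<in> set_pmf (batches n q q K).
            real (sfo_calls n q K \<xi>) \<le> C' * (real n + sqrt (real n) * (1 / \<epsilon>\<^sup>2)))))"
proof -
  define b where "b = smin / ((3 + sqrt 15) * L * smax\<^sup>2)"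
  \<comment> \<open>The gradient cost per squared direction divided by the guaranteed decrease per
    squared direction.\<close>
  define C where "C = 20 * (2 / smin\<^sup>2 + 20 * L\<^sup>2 * b\<^sup>2) / (smin / smax\<^sup>2 * b)"
  have "3 + sqrt 15 > 0" by (rule add_pos_nonneg) auto
  then have b: "b > 0" using assms by (simp add: b_def)
  have "2 / smin\<^sup>2 + 20 * L\<^sup>2 * b\<^sup>2 > 0" using assms by (intro add_pos_nonneg) auto
  then have C: "C > 0" using assms b by (simp add: C_def)
  \<comment> \<open>The oracle bound with \<open>X = C * (D / \<epsilon>\<^sup>2)\<close> has
    coefficients \<open>7\<close> and \<open>6 * C * D\<close>; their sum dominates both.\<close>
  have C': "7 + 6 * C * D > 0" if "D \<ge> 0" for D
    using that C by (intro add_pos_nonneg) auto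
  show ?thesis
    apply (rule exI[of _ C], rule conjI[OF C], rule allI, rule impI)
    subgoal for D
      apply (rule exI[of _ "7 + 6 * C * D"], rule conjI[OF C'], assumption)
      apply (intro allI impI conjI)
      subgoal premises prems for d n f \<kappa> q m \<delta> g0 \<alpha> \<beta> \<Lambda> x0 \<epsilon> K x y z v H
      proof -
        have h: "n \<ge> 1" "\<epsilon> > 0" "K \<ge> 1" "x0 \<in> carrier_vec d" "bdd_below (objective n f ` carrier_vec d)"
          "D = objective n f x0 - (INF u \<in> carrier_vec d. objective n f u)"
          "\<forall>i \<in> {1..n}. L_smooth d L (f i)"
          "q \<in> {nat \<lfloor>sqrt (real n)\<rfloor>, nat \<lceil>sqrt (real n)\<rceil>}"
          "\<forall>k. \<alpha> k = 2 / (real k + 1)" "\<forall>k. \<beta> k = b"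
          "\<forall>k<K. \<beta> k \<le> \<Lambda> k \<and> \<Lambda> k \<le> (1 + \<alpha> k) * \<beta> k"
          "\<forall>\<xi> \<in> set_pmf (batches n q q K).
             spider_sqn_m_run d n f q m \<delta> g0 \<alpha> \<beta> \<Lambda> K x0 \<xi> (x \<xi>) (y \<xi>) (z \<xi>) (v \<xi>) (H \<xi>)"
          "hessian_approx_bounded d smin smax K (batches n q q K) H"
          using prems(2) unfolding b_def by - ((elim conjE)?, assumption)+
        have \<alpha>: "\<alpha> = (\<lambda>k. 2 / (real k + 1))" and \<beta>: "\<beta> = (\<lambda>_. b)" using h(9,10) by auto
        interpret spider_random d n q m f L smin smax b \<delta> g0 \<Lambda> K x0 x y z v H
          using assms h rounded_sqrt_bounds(1)[OF h(1,8)] b_def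
          by unfold_locales (auto simp: \<alpha> \<beta>)
        \<comment> \<open>The infimum itself serves as the lower bound \<open>fmin\<close>.\<close>
        have "(INF u \<in> carrier_vec d. objective n f u) \<le> objective n f u"
          if "u \<in> carrier_vec d" for u
          by (rule cINF_lower[OF h(5) that])
        then show ?thesis
          using prems(3) h(2,3) unfolding C_def h(6)
          by (intro expect_grad_output_le)
      qed
      subgoal premises prems for d n f \<kappa> q m \<delta> g0 \<alpha> \<beta> \<Lambda> x0 \<epsilon> K x y z v H
      proof
        fix \<xi> assume \<xi>: "\<xi> \<in> set_pmf (batches n q q K)"
        have h: "n \<ge> 1" "\<epsilon> > 0" "q \<in> {nat \<lfloor>sqrt (real n)\<rfloor>, nat \<lceil>sqrt (real n)\<rceil>}"
          using prems(2) by blast+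
        have X: "0 \<le> C * (D / \<epsilon>\<^sup>2)" using C prems(1) by simp
        have "real (sfo_calls n q K \<xi>) \<le> 7 * real n + 6 * (C * (D / \<epsilon>\<^sup>2)) * sqrt (real n)"
          by (rule sfo_calls_le[OF h(1,3) X prems(3) \<xi>])
        also have "\<dots> = 7 * real n + (6 * C * D) * (sqrt (real n) * (1 / \<epsilon>\<^sup>2))" by simp
        also have "\<dots> \<le> (7 + 6 * C * D) * real n + (7 + 6 * C * D) * (sqrt (real n) * (1 / \<epsilon>\<^sup>2))"
          using C prems(1) by (intro add_mono mult_right_mono) auto
        finally show "real (sfo_calls n q K \<xi>) \<le> (7 + 6 * C * D) * (real n + sqrt (real n) * (1 / \<epsilon>\<^sup>2))"
          by (simp only: distrib_left)
      qed
      done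
    done
qed

end
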